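(* Assume that $n \alpha_n \to \alpha \in (0, \infty)$ and $\beta_n \to \beta \in [0, \infty)$ as $n\to\infty$. Then $\widetilde M_n$ converges in distribution to $H$ as $n\to\infty$, where $H$ is a distribution supported on $(0, \infty)$ whose $k$-th moment, for every positive integer $k$, is ${\mu_k}/\gamma_k$, where $\gamma_k$ is the $k$-th moment of the Gamma$(\alpha+\beta, 1)$ distribution and $\mu_k$ is the $k$-th moment of the distribution $F_\alpha$, given by $$\mu_k = \alpha \int_0^\infty x^{k-1} \exp \left( -x -\alpha \int_x^\infty \frac{e^{-u}}u\, du \right) dx.$$
   Context: Let $(\alpha_n)_{n\ge1}$ and $(\beta_n)_{n\ge1}$ be sequences of positive real numbers. For each $n$, let $\boldsymbol{X}_n=(X_{1n},\ldots,X_{nn})$ have the $n$-dimensional Dirichlet distribution with parameters $\alpha_n,\ldots,\alpha_n,\beta_n$ ($\alpha_n$ repeated $n$ times), i.e. with density $$\frac{\Gamma(n\alpha_n+\beta_n)}{\Gamma(\alpha_n)^n\,\Gamma(\beta_n)}\Bigl(\prod_{i=1}^n x_i\Bigr)^{\alpha_n-1}\Bigl(1-\sum_{i=1}^n x_i\Bigr)^{\beta_n-1}$$ on $\{\boldsymbol x: x_i\ge 0,\ 0\le\sum_{i=1}^n x_i\le 1\}$. Let $\widetilde M_n=\max\{X_{1n},\ldots,X_{nn}\}$. The Gamma$(\delta,1)$ distribution has density $u^{\delta-1}e^{-u}/\Gamma(\delta)$ on $(0,\infty)$. For $\alpha\in(0,\infty)$, $F_\alpha$ is the distribution on $(0,\infty)$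 with distribution function $F_\alpha(x)=\exp\left(-\alpha\int_x^\infty \frac{e^{-u}}{u}\,du\right)$, $x>0$. *)

theory Defs
  imports "HOL-Probability.Probability" "HOL-Real_Asymp.Real_Asymp"
begin

(* Points of R^n are extensional functions on {1..n}, and the density is taken with respect to
   the product Lebesgue measure on that index set.  "0 powr r = 0" only affects the boundary of
   the simplex, which is a null set. *)
definition dirichlet_density :: "nat \<Rightarrow> real \<Rightarrow> real \<Rightarrow> (nat \<Rightarrow> real) \<Rightarrow> real" where
  "dirichlet_density n a b x =
     (if (\<forall>i\<in>{1..n}. 0 \<le> x i) \<and> (\<Sum>i=1..n. x i) \<le> 1
      then Gamma (real n * a + b) / (Gamma a ^ n * Gamma b)
             * (\<Prod>i=1..n. x i) powr (a - 1) * (1 - (\<Sum>i=1..n. x i)) powr (b - 1)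
      else 0)"

definition gamma_density :: "real \<Rightarrow> real \<Rightarrow> real" where
  "gamma_density d u = (if 0 < u then u powr (d - 1) * exp (- u) / Gamma d else 0)"

definition gamma_distribution :: "real \<Rightarrow> real measure" where
  "gamma_distribution d = density lborel (\<lambda>u. ennreal (gamma_density d u))"

definition exp_int :: "real \<Rightarrow> real" where
  "exp_int x = (LBINT u:{x<..}. exp (- u) / u)"

definition F_cdf :: "real \<Rightarrow> real \<Rightarrow> real" where
  "F_cdf a x = (if 0 < x then exp (- a * exp_int x) else 0)"

(* interval_measure yields the measure with distribution function F_cdf a because F_cdf a
   is a distribution function; see cdf_F_distribution below. *)
definition F_distribution :: "real \<Rightarrow> real measure" where
  "F_distribution a = interval_measure (F_cdf a)"

lemma set_integrable_exp_int:
  assumes "0 < x"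
  shows "set_integrable lborel {x<..} (\<lambda>u::real. exp (- u) / u)"
proof -
  have "(\<lambda>u::real. exp (- 1 * u)) absolutely_integrable_on {x..}"
    by (intro nonnegative_absolutely_integrable_1 integrable_on_exp_minus_to_infinity) auto
  hence "set_integrable lborel {x..} (\<lambda>u::real. exp (- u))"
    by (simp add: set_integrable_def integrable_completion)
  hence "set_integrable lborel {x<..} (\<lambda>u::real. exp (- u))"
    by (rule set_integrable_subset) auto
  hence "set_integrable lborel {x<..} (\<lambda>u::real. exp (- u) / x)"
    using assms by simp
  thus ?thesis
  proof (rule set_integrable_bound)
    show "set_borel_measurable lborel {x<..} (\<lambda>u::real. exp (- u) / u)"
      unfolding set_borel_measurable_def by measurable
    show "AE u in lborel. u \<in> {x<..} \<longrightarrow> norm (exp (- u) / u) \<le> norm (exp (- u) / x)"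
      using assms by (auto intro!: AE_I2 frac_le simp: abs_of_pos)
  qed
qed

lemma exp_int_nonneg: "0 < x \<Longrightarrow> 0 \<le> exp_int x"
  unfolding exp_int_def set_lebesgue_integral_def
  by (rule integral_nonneg_AE) (auto intro!: AE_I2 split: split_indicator)

lemma exp_int_split:
  assumes "0 < x" "x \<le> y"
  shows "exp_int x = (LBINT u:{x<..y}. exp (- u) / u) + exp_int y"
proof -
  have "{x<..} = {x<..y} \<union> {y<..}" using assms by auto
  moreover have "set_integrable lborel {x<..y} (\<lambda>u::real. exp (- u) / u)"
    by (rule set_integrable_subset[OF set_integrable_exp_int[OF assms(1)]]) auto
  moreover have "set_integrable lborel {y<..} (\<lambda>u::real. exp (- u) / u)"
    by (rule set_integrable_exp_int) (use assms in simp)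
  moreover have "{x<..y} \<inter> {y<..} = {}" by auto
  ultimately show ?thesis
    unfolding exp_int_def by (simp only: set_integral_Un)
qed

lemma exp_int_Ioc_bounds:
  fixes x y :: real
  assumes "0 < x" "x \<le> y"
  shows "exp (- y) / y * (y - x) \<le> (LBINT u:{x<..y}. exp (- u) / u)" (is ?A)
    and "(LBINT u:{x<..y}. exp (- u) / u) \<le> exp (- x) / x * (y - x)" (is ?B)
proof -
  have i: "set_integrable lborel {x<..y} (\<lambda>u::real. exp (- u) / u)"
    by (rule set_integrable_subset[OF set_integrable_exp_int[OF assms(1)]]) auto
  have c: "set_integrable lborel {x<..y} (\<lambda>u::real. c)" for c :: real
    unfolding set_integrable_def using assms by auto
  have e: "(LBINT u:{x<..y}. c) = c * (y - x)" for c :: real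
    using assms by (simp add: set_lebesgue_integral_def)
  show ?A unfolding e[symmetric]
    by (rule set_integral_mono[OF c i]) (use assms in \<open>auto intro!: frac_le\<close>)
  show ?B unfolding e[symmetric]
    by (rule set_integral_mono[OF i c]) (use assms in \<open>auto intro!: frac_le\<close>)
qed

lemma exp_int_lower:
  assumes "0 < x" "x \<le> 1"
  shows "- exp (- 1) * ln x \<le> exp_int x"
proof -
  have ii: "(\<lambda>u::real. exp (- 1) / u) absolutely_integrable_on {x..1}"
    and hi: "((\<lambda>u::real. exp (- 1) / u) has_integral (exp (- 1) * ln 1 - exp (- 1) * ln x)) {x..1}"
  proof -
    show hi: "((\<lambda>u::real. exp (- 1) / u) has_integral (exp (- 1) * ln 1 - exp (- 1) * ln x)) {x..1}"
      using assms
      by (intro fundamental_theorem_of_calculus)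
         (auto intro!: derivative_eq_intros simp: has_real_derivative_iff_has_vector_derivative[symmetric])
    show "(\<lambda>u::real. exp (- 1) / u) absolutely_integrable_on {x..1}"
      using assms hi by (intro nonnegative_absolutely_integrable_1) (auto simp: integrable_on_def)
  qed
  have l: "set_integrable lborel {x..1} (\<lambda>u::real. exp (- 1) / u)"
    using ii by (simp add: set_integrable_def integrable_completion)
  have l': "set_integrable lborel {x<..1} (\<lambda>u::real. exp (- 1) / u)"
    by (rule set_integrable_subset[OF l]) auto
  have "- exp (- 1) * ln x = (LBINT u:{x..1}. exp (- 1) / u)"
    using set_borel_integral_eq_integral(2)[OF l] integral_unique[OF hi] by simp
  also have "\<dots> = (LBINT u:{x<..1}. exp (- 1) / u)"
    unfolding set_lebesgue_integral_def
    by (rule integral_cong_AE)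
       (use AE_lborel_singleton[of x] in \<open>auto elim!: eventually_mono split: split_indicator\<close>)
  also have "\<dots> \<le> (LBINT u:{x<..1}. exp (- u) / u)"
    by (rule set_integral_mono[OF l'])
       (use assms in \<open>auto intro!: set_integrable_subset[OF set_integrable_exp_int[OF assms(1)]] divide_right_mono\<close>)
  also have "\<dots> \<le> exp_int x"
    using exp_int_split[OF assms] exp_int_nonneg[of 1] by simp
  finally show ?thesis .
qed

lemma exp_int_upper: "0 < x \<Longrightarrow> exp_int x \<le> exp (- x) / x"
proof -
  assume x: "0 < x"
  have hi: "((\<lambda>u::real. exp (- 1 * u)) has_integral exp (- 1 * x) / 1) {x..}"
    by (rule has_integral_exp_minus_to_infinity) simp
  have "(\<lambda>u::real. exp (- 1 * u)) absolutely_integrable_on {x..}"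
    by (intro nonnegative_absolutely_integrable_1 integrable_on_exp_minus_to_infinity) auto
  hence l: "set_integrable lborel {x..} (\<lambda>u::real. exp (- u))"
    by (simp add: set_integrable_def integrable_completion)
  hence l': "set_integrable lborel {x<..} (\<lambda>u::real. exp (- u))"
    by (rule set_integrable_subset) auto
  have "exp_int x \<le> (LBINT u:{x<..}. exp (- u) / x)"
    unfolding exp_int_def
    by (rule set_integral_mono[OF set_integrable_exp_int[OF x]])
       (use x l' in \<open>auto intro!: frac_le\<close>)
  also have "\<dots> = (LBINT u:{x<..}. exp (- u)) / x" by simp
  also have "(LBINT u:{x<..}. exp (- u)) = (LBINT u:{x..}. exp (- u))"
    unfolding set_lebesgue_integral_def
    by (rule integral_cong_AE)
       (use AE_lborel_singleton[of x] in \<open>auto elim!: eventually_mono split: split_indicator\<close>)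
  also have "\<dots> = exp (- x)"
    using set_borel_integral_eq_integral(2)[OF l] integral_unique[OF hi] by simp
  finally show ?thesis .
qed

lemma F_cdf_properties:
  assumes a: "0 < a"
  shows F_cdf_mono: "x \<le> y \<Longrightarrow> F_cdf a x \<le> F_cdf a y"
    and F_cdf_right_cont: "continuous (at_right x) (F_cdf a)"
    and F_cdf_at_bot: "(F_cdf a \<longlongrightarrow> 0) at_bot"
    and F_cdf_at_top: "(F_cdf a \<longlongrightarrow> 1) at_top"
proof -
  show "F_cdf a x \<le> F_cdf a y" if "x \<le> y"
  proof (cases "0 < x")
    case True
    have "0 \<le> exp (- y) / y * (y - x)" using True that by simp
    with True that have "exp_int y \<le> exp_int x"
      using exp_int_split[of x y] exp_int_Ioc_bounds(1)[of x y] by linarith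
    with True that a show ?thesis by (simp add: F_cdf_def)
  qed (simp add: F_cdf_def)
  show "(F_cdf a \<longlongrightarrow> 0) at_bot"
    by (rule tendsto_eventually) (auto simp: F_cdf_def eventually_at_bot_linorder intro!: exI[of _ 0])
  have "(exp_int \<longlongrightarrow> 0) at_top"
  proof (rule tendsto_sandwich[of "\<lambda>_. 0" _ _ "\<lambda>x. exp (- x) / x"])
    show "((\<lambda>x::real. exp (- x) / x) \<longlongrightarrow> 0) at_top" by real_asymp
    show "\<forall>\<^sub>F x in at_top. exp_int x \<le> exp (- x) / x"
      using eventually_gt_at_top[of 0] by eventually_elim (rule exp_int_upper)
    show "\<forall>\<^sub>F x in at_top. 0 \<le> exp_int x"
      using eventually_gt_at_top[of 0] by eventually_elim (rule exp_int_nonneg)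
  qed auto
  hence "((\<lambda>x. exp (- a * exp_int x)) \<longlongrightarrow> exp (- a * 0)) at_top"
    by (intro tendsto_intros)
  moreover have "\<forall>\<^sub>F x in at_top. exp (- a * exp_int x) = F_cdf a x"
    using eventually_gt_at_top[of 0] by eventually_elim (simp add: F_cdf_def)
  ultimately show "(F_cdf a \<longlongrightarrow> 1) at_top" by (auto dest: Lim_transform_eventually)
  consider "x < 0" | "x = 0" | "0 < x" by linarith
  thus "continuous (at_right x) (F_cdf a)"
  proof cases
    case 1
    have "\<forall>\<^sub>F y in at_right x. y < 0"
      using 1 by (auto simp: eventually_at_right)
    hence "\<forall>\<^sub>F y in at_right x. F_cdf a y = F_cdf a x"
      by eventually_elim (use 1 in \<open>simp add: F_cdf_def\<close>)
    thus ?thesis unfolding continuous_within by (rule tendsto_eventually)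
  next
    case 2
    have ev: "\<forall>\<^sub>F y in at_right (0::real). 0 < y \<and> y \<le> 1"
      unfolding eventually_at_right_field by (intro exI[of _ 1]) auto
    have "(F_cdf a \<longlongrightarrow> 0) (at_right 0)"
    proof (rule tendsto_sandwich[of "\<lambda>_. 0" _ _ "\<lambda>y. exp (a * exp (- 1) * ln y)"])
      show "((\<lambda>y::real. exp (a * exp (- 1) * ln y)) \<longlongrightarrow> 0) (at_right 0)"
        using a by real_asymp
      show "\<forall>\<^sub>F y in at_right 0. F_cdf a y \<le> exp (a * exp (- 1) * ln y)"
        using ev
      proof eventually_elim
        case (elim y)
        have "a * (- exp (- 1) * ln y) \<le> a * exp_int y"
          by (rule mult_left_mono) (use elim a exp_int_lower[of y] in auto)
        thus ?case using elim by (simp add: F_cdf_def)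
      qed
    qed (auto simp: F_cdf_def)
    thus ?thesis using 2 by (simp add: continuous_within F_cdf_def)
  next
    case 3
    have ev: "\<forall>\<^sub>F y in at_right x. x < y" by (rule eventually_at_right_less)
    have "(exp_int \<longlongrightarrow> exp_int x) (at_right x)"
    proof (rule tendsto_sandwich[of "\<lambda>y. exp_int x - exp (- x) / x * (y - x)" _ _ "\<lambda>_. exp_int x"])
      have "((\<lambda>y. exp_int x - exp (- x) / x * (y - x)) \<longlongrightarrow> exp_int x - exp (- x) / x * (x - x)) (at_right x)"
        by (intro tendsto_intros)
      thus "((\<lambda>y. exp_int x - exp (- x) / x * (y - x)) \<longlongrightarrow> exp_int x) (at_right x)" by simp
      show "\<forall>\<^sub>F y in at_right x. exp_int x - exp (- x) / x * (y - x) \<le> exp_int y"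
        using ev
      proof eventually_elim
        case (elim y)
        thus ?case using exp_int_split[of x y] exp_int_Ioc_bounds(2)[of x y] 3 by linarith
      qed
      show "\<forall>\<^sub>F y in at_right x. exp_int y \<le> exp_int x"
        using ev
      proof eventually_elim
        case (elim y)
        have "0 \<le> exp (- y) / y * (y - x)" using 3 elim by simp
        thus ?case using exp_int_split[of x y] exp_int_Ioc_bounds(1)[of x y] 3 elim by linarith
      qed
    qed auto
    hence "((\<lambda>y. exp (- a * exp_int y)) \<longlongrightarrow> exp (- a * exp_int x)) (at_right x)"
      by (intro tendsto_intros)
    moreover have "\<forall>\<^sub>F y in at_right x. exp (- a * exp_int y) = F_cdf a y"
      using ev by eventually_elim (use 3 in \<open>simp add: F_cdf_def\<close>)
    ultimately have "(F_cdf a \<longlongrightarrow> exp (- a * exp_int x)) (at_right x)"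
      by (rule Lim_transform_eventually)
    thus ?thesis using 3 by (simp add: continuous_within F_cdf_def)
  qed
qed

lemma real_distribution_F_distribution: "0 < a \<Longrightarrow> real_distribution (F_distribution a)"
  unfolding F_distribution_def
  by (rule real_distribution_interval_measure) (auto intro: F_cdf_properties)

lemma cdf_F_distribution: "0 < a \<Longrightarrow> cdf (F_distribution a) = F_cdf a"
  unfolding F_distribution_def
  by (rule cdf_interval_measure) (auto intro: F_cdf_properties)

end

theory Submission
  imports Defs
begin

text \<open>
  If \<open>S\<close> is a Gamma variable with parameter \<open>n * a n + b n\<close>, independent of the Dirichlet maximum
  \<open>M\<close>, then \<open>S * M\<close> is distributed as the maximum of \<open>n\<close> independent Gamma variables with
  parameter \<open>a n\<close>. Hence the moments of \<open>M\<close> are quotients of those of the Gamma maximum and of \<open>S\<close>.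
  The distribution function of the Gamma maximum is the power \<open>(1 - r n) ^ n\<close> with
  \<open>n * r n \<longlonglongrightarrow> \<alpha> * exp_int x\<close>, so it tends to \<open>F_cdf \<alpha>\<close>, and by dominated convergence of the tail
  probabilities its moments converge as well. Since \<open>M\<close> takes values in the unit interval, convergence of
  its moments yields a weak limit. This limit has no atom at \<open>0\<close>, because a small \<open>M\<close>
  would make the Gamma maximum \<open>S * M\<close> small, while \<open>F_cdf \<alpha>\<close> tends to \<open>0\<close> at \<open>0\<close>.
\<close>

section \<open>Gamma densities and scaling of product Lebesgue measure\<close>

text \<open>The coordinates of a Dirichlet vector are tied together by the bound on their sum; the
  random total \<open>S\<close> dissolves this dependence, and independence lets it be divided out
  again because the k-th moment of \<open>S * M\<close> factors. For distribution functions no such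
  division is available, which is why the limit is reached through moments.

  The limit \<open>exp_int\<close> has its origin in the behaviour of \<open>Gamma z\<close> like
  1/z near 0: n times the density of one Gamma variable with parameter \<open>a n\<close> tends to
  \<alpha> * exp (- u) / u. This function is not integrable at 0, so domination is available only on
  tails away from 0, or after multiplication by u^k with k at least 1.

  The value \<beta> = 0 causes no trouble: in the limit only the total parameter \<alpha> + \<beta>
  of \<open>S\<close> matters, and it stays positive.

  The Gamma identities are kept as nonnegative integrals, so that no integrability has to be settled
  before integrals are exchanged.\<close>

lemma borel_measurable_gamma_density [measurable]: "gamma_density d \<in> borel_measurable borel"
  unfolding gamma_density_def[abs_def] by measurable

lemma gamma_density_nonneg: "0 < d \<Longrightarrow> 0 \<le> gamma_density d u"
  unfolding gamma_density_def by (auto intro!: divide_nonneg_pos Gamma_real_pos)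

lemma gamma_density_nonpos [simp]: "u \<le> 0 \<Longrightarrow> gamma_density d u = 0"
  by (simp add: gamma_density_def)

lemma nn_integral_gamma_density_power:
  assumes "0 < d"
  shows "(\<integral>\<^sup>+u. ennreal (gamma_density d u) * ennreal (u ^ k) \<partial>lborel) = ennreal (Gamma (d + real k) / Gamma d)"
proof -
  have "((\<lambda>t. t powr (d + k - 1) / exp t) has_integral Gamma (d + k)) {0..}"
    using assms by (intro Gamma_integral_real) simp
  hence "((\<lambda>t. (t powr (d + k - 1) / exp t) / Gamma d) has_integral Gamma (d + k) / Gamma d) {0..}"
    by (rule has_integral_divide)
  hence "integral\<^sup>N lborel (\<lambda>t. ennreal ((t powr (d + k - 1) / exp t) / Gamma d) * indicator {0..} t)
      = ennreal (Gamma (d + k) / Gamma d)"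
    using assms by (intro nn_integral_has_integral_lebesgue') (auto intro!: divide_nonneg_pos Gamma_real_pos)
  also have "integral\<^sup>N lborel (\<lambda>t. ennreal ((t powr (d + k - 1) / exp t) / Gamma d) * indicator {0..} t)
     = (\<integral>\<^sup>+u. ennreal (gamma_density d u) * ennreal (u ^ k) \<partial>lborel)"
  proof (rule nn_integral_cong)
    fix t :: real
    show "ennreal ((t powr (d + k - 1) / exp t) / Gamma d) * indicator {0..} t
       = ennreal (gamma_density d t) * ennreal (t ^ k)"
    proof (cases "0 < t")
      case True
      have "t powr (d + k - 1) = t powr (d - 1) * t ^ k"
        using True by (simp add: powr_add[symmetric] powr_realpow[symmetric] algebra_simps)
      thus ?thesis using True assms
        by (simp add: ennreal_mult'[symmetric] gamma_density_def exp_minus field_simps)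
    qed (simp split: split_indicator)
  qed
  finally show ?thesis .
qed

lemma nn_integral_gamma_density: "0 < d \<Longrightarrow> (\<integral>\<^sup>+u. ennreal (gamma_density d u) \<partial>lborel) = 1"
  using nn_integral_gamma_density_power[of d 0] by (simp add: less_imp_neq[OF Gamma_real_pos, symmetric])

text \<open>Each coordinate contributes one factor \<open>s\<close> by the one-dimensional affine
  substitution, and induction on the index set collects them. The scaled point is restricted to
  \<open>I\<close> so that it stays an extensional function.\<close>

lemma nn_integral_PiM_lborel_scale:
  fixes s :: real
  assumes s: "0 < s" and "finite I" and "g \<in> borel_measurable (Pi\<^sub>M I (\<lambda>_. lborel :: real measure))"
  shows "(\<integral>\<^sup>+x. g x \<partial>Pi\<^sub>M I (\<lambda>_. lborel)) =
         ennreal (s ^ card I) * (\<integral>\<^sup>+x. g (\<lambda>i\<in>I. s * x i) \<partial>Pi\<^sub>M I (\<lambda>_. lborel))"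
  using assms(2,3)
proof (induction I arbitrary: g)
  case empty
  then show ?case by (simp add: PiM_empty nn_integral_count_space_finite)
next
  case (insert i I)
  interpret product_sigma_finite "\<lambda>_::'a. lborel :: real measure" ..
  interpret finite_product_sigma_finite "\<lambda>_::'a. lborel :: real measure" I by standard (rule insert.hyps)
  note [measurable] = insert.prems
  have m[measurable]: "(\<lambda>x. \<lambda>j\<in>J. s * x j) \<in> Pi\<^sub>M J (\<lambda>_. lborel) \<rightarrow>\<^sub>M Pi\<^sub>M J (\<lambda>_. lborel :: real measure)" for J :: "'a set"
    by measurable
  have "(\<integral>\<^sup>+x. g x \<partial>Pi\<^sub>M (insert i I) (\<lambda>_. lborel)) =
      (\<integral>\<^sup>+y. (\<integral>\<^sup>+x. g (x(i := y)) \<partial>Pi\<^sub>M I (\<lambda>_. lborel)) \<partial>lborel)"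
    using insert by (intro product_nn_integral_insert_rev) auto
  also have "\<dots> = ennreal s * (\<integral>\<^sup>+y. (\<integral>\<^sup>+x. g (x(i := s * y)) \<partial>Pi\<^sub>M I (\<lambda>_. lborel)) \<partial>lborel)"
  proof (subst nn_integral_real_affine[where c=s and t=0])
    have "(\<lambda>y. \<integral>\<^sup>+x. g (x(i := y)) \<partial>Pi\<^sub>M I (\<lambda>_. lborel)) \<in> borel_measurable lborel"
      by measurable
    thus "(\<lambda>y. \<integral>\<^sup>+x. g (x(i := y)) \<partial>Pi\<^sub>M I (\<lambda>_. lborel)) \<in> borel_measurable borel"
      by simp
  qed (use s in auto)
  also have "(\<integral>\<^sup>+y. (\<integral>\<^sup>+x. g (x(i := s * y)) \<partial>Pi\<^sub>M I (\<lambda>_. lborel)) \<partial>lborel) =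
     (\<integral>\<^sup>+y. ennreal (s ^ card I) * (\<integral>\<^sup>+x. g ((\<lambda>j\<in>I. s * x j)(i := s * y)) \<partial>Pi\<^sub>M I (\<lambda>_. lborel)) \<partial>lborel)"
    by (intro nn_integral_cong insert.IH) measurable
  also have "\<dots> = ennreal (s ^ card I) * (\<integral>\<^sup>+y. (\<integral>\<^sup>+x. g ((\<lambda>j\<in>I. s * x j)(i := s * y)) \<partial>Pi\<^sub>M I (\<lambda>_. lborel)) \<partial>lborel)"
    by (rule nn_integral_cmult) measurable
  also have "(\<integral>\<^sup>+y. (\<integral>\<^sup>+x. g ((\<lambda>j\<in>I. s * x j)(i := s * y)) \<partial>Pi\<^sub>M I (\<lambda>_. lborel)) \<partial>lborel)
     = (\<integral>\<^sup>+y. (\<integral>\<^sup>+x. g (\<lambda>j\<in>insert i I. s * (x(i:=y)) j) \<partial>Pi\<^sub>M I (\<lambda>_. lborel)) \<partial>lborel)"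
    using insert.hyps by (intro nn_integral_cong arg_cong[where f=g]) (auto simp: fun_eq_iff)
  also have "\<dots> = (\<integral>\<^sup>+x. g (\<lambda>j\<in>insert i I. s * x j) \<partial>Pi\<^sub>M (insert i I) (\<lambda>_. lborel))"
    using insert by (intro product_nn_integral_insert_rev[symmetric]) auto
  also have "ennreal s * (ennreal (s ^ card I) * \<dots>) = ennreal (s ^ card (insert i I)) * \<dots>"
    using insert.hyps s by (simp add: ennreal_mult mult.assoc)
  finally show ?case .
qed

section \<open>Moments as integrals of tail probabilities\<close>

text \<open>Layer-cake formula: f^k is the integral of k * t^(k-1) over [0, f], and Tonelli
  exchanges the two integrals. Sigma-finiteness is the right generality because the formula is also
  applied to the measure with density \<open>envelope\<close>, whose total mass is infinite.\<close>

lemma nn_integral_power_eq_tails: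
  fixes f :: "'a \<Rightarrow> real"
  assumes "sigma_finite_measure M" and [measurable]: "f \<in> borel_measurable M"
    and nonneg: "AE x in M. 0 \<le> f x" and k: "1 \<le> k"
  shows "(\<integral>\<^sup>+x. ennreal (f x ^ k) \<partial>M) =
     (\<integral>\<^sup>+t. ennreal (k * t ^ (k - 1)) * indicator {0<..} t * emeasure M {x\<in>space M. t < f x} \<partial>lborel)"
proof -
  interpret sigma_finite_measure M by fact
  interpret pair_sigma_finite M lborel ..
  have "(\<integral>\<^sup>+x. ennreal (f x ^ k) \<partial>M) =
     (\<integral>\<^sup>+x. (\<integral>\<^sup>+t. ennreal (k * t ^ (k - 1)) * indicator {0<..} t * indicator {x\<in>space M. t < f x} x \<partial>lborel) \<partial>M)"
  proof (rule nn_integral_cong_AE, use nonneg AE_space in eventually_elim)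
    fix x assume x: "0 \<le> f x" "x \<in> space M"
    have "(\<integral>\<^sup>+t. ennreal (k * t ^ (k - 1)) * indicator {0<..} t * indicator {x\<in>space M. t < f x} x \<partial>lborel)
       = (\<integral>\<^sup>+t. ennreal (k * t ^ (k - 1)) * indicator {0..f x} t \<partial>lborel)"
      by (intro nn_integral_cong_AE)
         (use AE_lborel_singleton[of 0] AE_lborel_singleton[of "f x"] x in \<open>auto elim!: eventually_elim2 split: split_indicator\<close>)
    also have "\<dots> = ennreal (f x ^ k - 0 ^ k)"
      using x k by (intro nn_integral_FTC_Icc) (auto intro!: derivative_eq_intros)
    finally show "ennreal (f x ^ k) =
      (\<integral>\<^sup>+t. ennreal (k * t ^ (k - 1)) * indicator {0<..} t * indicator {x\<in>space M. t < f x} x \<partial>lborel)"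
      using k by (simp add: power_0_left)
  qed
  also have "\<dots> = (\<integral>\<^sup>+t. (\<integral>\<^sup>+x. ennreal (k * t ^ (k - 1)) * indicator {0<..} t * indicator {x\<in>space M. t < f x} x \<partial>M) \<partial>lborel)"
    by (intro Fubini'[symmetric]) measurable
  also have "\<dots> = (\<integral>\<^sup>+t. ennreal (k * t ^ (k - 1)) * indicator {0<..} t * emeasure M {x\<in>space M. t < f x} \<partial>lborel)"
    by (intro nn_integral_cong) (simp add: nn_integral_cmult)
  finally show ?thesis .
qed


section \<open>The maximum of a Dirichlet vector times an independent Gamma variable\<close>

text \<open>The substitution \<open>x = y / s\<close> turns the joint density of a Dirichlet vector \<open>x\<close> and an
  independent Gamma variable \<open>s\<close> into that of independent Gamma variables \<open>y\<^sub>i\<close> with total \<open>s\<close>; the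
  factor \<open>s ^ n\<close> is the Jacobian. On the boundary both sides vanish because \<open>0 powr r = 0\<close>.\<close>
lemma dirichlet_gamma_kernel:
  fixes y :: "nat \<Rightarrow> real"
  assumes a: "0 < a" and b: "0 < b" and s: "0 < s"
  shows "gamma_density (real n * a + b) s * dirichlet_density n a b (\<lambda>i\<in>{1..n}. y i / s) =
         s ^ n * ((\<Prod>i=1..n. gamma_density a (y i)) * gamma_density b (s - (\<Sum>i=1..n. y i)))"
proof -
  let ?z = "\<lambda>i\<in>{1..n}. y i / s"
  let ?S = "\<Sum>i=1..n. y i" and ?P = "\<Prod>i=1..n. y i"
  have sum_z: "(\<Sum>i=1..n. ?z i) = ?S / s" by (simp add: sum_divide_distrib)
  have prod_z: "(\<Prod>i=1..n. ?z i) = ?P / s ^ n" by (simp add: prod_dividef)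
  have nonneg_z: "(\<forall>i\<in>{1..n}. 0 \<le> ?z i) \<longleftrightarrow> (\<forall>i\<in>{1..n}. 0 \<le> y i)"
    using s by (auto simp: zero_le_divide_iff)
  have D: "dirichlet_density n a b ?z = (if (\<forall>i\<in>{1..n}. 0 \<le> y i) \<and> ?S \<le> s
      then Gamma (real n * a + b) / (Gamma a ^ n * Gamma b)
             * (?P / s ^ n) powr (a - 1) * (1 - ?S / s) powr (b - 1) else 0)"
    unfolding dirichlet_density_def sum_z prod_z nonneg_z using s by simp
  show ?thesis
  proof (cases "(\<forall>i\<in>{1..n}. 0 < y i) \<and> ?S < s")
    case True
    hence P: "0 < ?P" by (intro prod_pos) auto
    have c: "0 < real n * a + b" using a b by (simp add: add_nonneg_pos)
    have G: "Gamma (real n * a + b) > 0" "Gamma a > 0" "Gamma b > 0"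
      using a b c by (auto intro: Gamma_real_pos)
    have "(\<Prod>i=1..n. gamma_density a (y i)) = (\<Prod>i=1..n. y i powr (a - 1) * exp (- y i) / Gamma a)"
      using True by (intro prod.cong) (auto simp: gamma_density_def)
    also have "\<dots> = ?P powr (a - 1) * exp (- ?S) / Gamma a ^ n"
      using True by (simp add: prod_dividef prod.distrib prod_powr_distrib less_imp_le exp_sum sum_negf[symmetric])
    finally have pr: "(\<Prod>i=1..n. gamma_density a (y i)) = ?P powr (a - 1) * exp (- ?S) / Gamma a ^ n" .
    have "1 - ?S / s = (s - ?S) / s" using s by (simp add: field_simps)
    hence e1: "(1 - ?S / s) powr (b - 1) = (s - ?S) powr (b - 1) / s powr (b - 1)"
      using True s by (simp add: powr_divide)
    have "(s ^ n) powr (a - 1) = s powr (n * (a - 1))"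
      using s by (simp add: powr_realpow[symmetric] powr_powr)
    hence e2: "(?P / s ^ n) powr (a - 1) = ?P powr (a - 1) / s powr (n * (a - 1))"
      using P s by (simp add: powr_divide)
    \<comment> \<open>The exponent splits into the Jacobian \<open>s ^ n\<close> and two powers that
      cancel the denominators produced by rescaling the product of coordinates (\<open>e2\<close>)
      and the remaining mass (\<open>e1\<close>).\<close>
    have "s powr (real n * a + b - 1) = s powr (real n + n * (a - 1) + (b - 1))"
      by (simp add: algebra_simps)
    hence e3: "s powr (real n * a + b - 1) = s ^ n * s powr (n * (a - 1)) * s powr (b - 1)"
      using s by (simp only: powr_add powr_realpow)
    have e4: "exp (- (s - ?S)) * exp (- ?S) = exp (- s)"
      by (simp add: exp_add[symmetric])
    have "gamma_density (real n * a + b) s * dirichlet_density n a b ?z =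
      (s ^ n * s powr (n * (a - 1)) * s powr (b - 1)) * exp (- s) / Gamma (real n * a + b) *
      (Gamma (real n * a + b) / (Gamma a ^ n * Gamma b) * (?P powr (a - 1) / s powr (n * (a - 1)))
       * ((s - ?S) powr (b - 1) / s powr (b - 1)))"
      unfolding D gamma_density_def[of _ s] e1 e2 e3 using True s by (auto simp: less_imp_le)
    also have "\<dots> = s ^ n * ((?P powr (a - 1) * exp (- ?S) / Gamma a ^ n) * ((s - ?S) powr (b - 1) * exp (- (s - ?S)) / Gamma b))"
      unfolding e4[symmetric] using G s by (simp add: divide_simps)
    also have "\<dots> = s ^ n * ((\<Prod>i=1..n. gamma_density a (y i)) * gamma_density b (s - ?S))"
    proof -
      have "gamma_density b (s - ?S) = (s - ?S) powr (b - 1) * exp (- (s - ?S)) / Gamma b"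
        using True by (subst gamma_density_def) simp
      thus ?thesis unfolding pr by simp
    qed
    finally show ?thesis .
  next
    case False
    have "dirichlet_density n a b ?z = 0"
    proof (cases "(\<forall>i\<in>{1..n}. 0 \<le> y i) \<and> ?S \<le> s")
      case True
      with False have "(\<exists>i\<in>{1..n}. y i = 0) \<or> ?S = s"
        by (meson linorder_not_less order_antisym)
      hence "?P = 0 \<or> ?S = s" by (auto simp: prod_zero_iff)
      thus ?thesis unfolding D using s by auto
    next
      case False
      thus ?thesis unfolding D by (simp only: False if_False)
    qed
    moreover have "(\<Prod>i=1..n. gamma_density a (y i)) * gamma_density b (s - ?S) = 0"
      using False by (force simp: prod_zero_iff not_less)
    ultimately show ?thesis by simp
  qed
qed

lemma borel_measurable_dirichlet_density [measurable]:
  "dirichlet_density n a b \<in> borel_measurable (Pi\<^sub>M {1..n} (\<lambda>_. lborel))"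
  unfolding dirichlet_density_def[abs_def] by measurable

lemma dirichlet_density_nonneg: "0 < a \<Longrightarrow> 0 < b \<Longrightarrow> 0 \<le> dirichlet_density n a b x"
  unfolding dirichlet_density_def
  by (auto intro!: mult_nonneg_nonneg divide_nonneg_pos Gamma_real_pos less_imp_le[OF Gamma_real_pos] add_nonneg_pos
     zero_less_power mult_pos_pos)

text \<open>The joint law is written as a density over product Lebesgue measure, the form in which
  the rescaled Dirichlet kernel appears. The case n = 0 involves the unspecified
  \<open>Max {}\<close>, so results that evaluate the maximum assume
  \<open>1 \<le> n\<close>.\<close>

definition gamma_max_law :: "nat \<Rightarrow> real \<Rightarrow> real measure" where
  "gamma_max_law n a = distr (density (Pi\<^sub>M {1..n} (\<lambda>_. lborel)) (\<lambda>y. \<Prod>i=1..n. ennreal (gamma_density a (y i))))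
     borel (\<lambda>y. Max (y ` {1..n}))"

lemma measurable_Max_PiM [measurable]:
  "finite I \<Longrightarrow> (\<lambda>y. Max (y ` I) :: real) \<in> borel_measurable (Pi\<^sub>M I (\<lambda>_. lborel))"
  by measurable

lemma sets_gamma_max_law [measurable_cong, simp]: "sets (gamma_max_law n a) = sets borel"
  and space_gamma_max_law [simp]: "space (gamma_max_law n a) = UNIV"
  by (simp_all add: gamma_max_law_def)

lemma nn_integral_gamma_max_law:
  assumes [measurable]: "h \<in> borel_measurable borel"
  shows "(\<integral>\<^sup>+u. h u \<partial>gamma_max_law n a) = (\<integral>\<^sup>+y. (\<Prod>i=1..n. ennreal (gamma_density a (y i))) * h (Max (y ` {1..n}))
    \<partial>Pi\<^sub>M {1..n} (\<lambda>_. lborel))"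
  unfolding gamma_max_law_def by (simp add: nn_integral_distr nn_integral_density)

text \<open>The maximum is at most \<open>x\<close> exactly when every coordinate is, so the
  indicator factors and the product integral becomes a power.\<close>

lemma emeasure_gamma_max_law_atMost:
  assumes n: "1 \<le> n"
  shows "emeasure (gamma_max_law n a) {..x} = (\<integral>\<^sup>+u. ennreal (gamma_density a u) * indicator {..x} u \<partial>lborel) ^ n"
proof -
  interpret product_sigma_finite "\<lambda>_::nat. lborel :: real measure" ..
  have "emeasure (gamma_max_law n a) {..x} = (\<integral>\<^sup>+u. indicator {..x} u \<partial>gamma_max_law n a)"
    by (subst nn_integral_indicator) auto
  also have "\<dots> = (\<integral>\<^sup>+y. (\<Prod>i=1..n. ennreal (gamma_density a (y i)) * indicator {..x} (y i)) \<partial>Pi\<^sub>M {1..n} (\<lambda>_. lborel))"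
  proof (subst nn_integral_gamma_max_law, simp, rule nn_integral_cong)
    fix y :: "nat \<Rightarrow> real"
    have "indicator {..x} (Max (y ` {1..n})) = (\<Prod>i=1..n. indicator {..x} (y i) :: ennreal)"
      using n by (cases "\<forall>i\<in>{1..n}. y i \<le> x") (auto simp: indicator_def prod_zero_iff Max_le_iff)
    thus "(\<Prod>i=1..n. ennreal (gamma_density a (y i))) * indicator {..x} (Max (y ` {1..n})) =
       (\<Prod>i=1..n. ennreal (gamma_density a (y i)) * indicator {..x} (y i))"
      by (simp add: prod.distrib)
  qed
  also have "\<dots> = (\<Prod>i=1..n. \<integral>\<^sup>+u. ennreal (gamma_density a u) * indicator {..x} u \<partial>lborel)"
    by (intro product_nn_integral_prod) auto
  finally show ?thesis by simp
qed

lemma prob_space_gamma_max_law: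
  assumes "0 < a"
  shows "prob_space (gamma_max_law n a)"
proof
  interpret product_sigma_finite "\<lambda>_::nat. lborel :: real measure" ..
  have "emeasure (gamma_max_law n a) (space (gamma_max_law n a)) = (\<integral>\<^sup>+u. 1 \<partial>gamma_max_law n a)"
    by simp
  also have "\<dots> = (\<integral>\<^sup>+y. (\<Prod>i=1..n. ennreal (gamma_density a (y i))) \<partial>Pi\<^sub>M {1..n} (\<lambda>_. lborel))"
    by (subst nn_integral_gamma_max_law) auto
  also have "\<dots> = (\<Prod>i=1..n. \<integral>\<^sup>+u. ennreal (gamma_density a u) \<partial>lborel)"
    by (intro product_nn_integral_prod) auto
  finally show "emeasure (gamma_max_law n a) (space (gamma_max_law n a)) = 1"
    using assms by (simp add: nn_integral_gamma_density)
qed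

text \<open>For fixed total \<open>s\<close> the scaling y = s * x turns the integrand into
  independent Gamma densities of the y's times a Gamma density of the remainder s - sum y;
  integrating over \<open>s\<close> then removes the remainder. A general test function
  \<open>h\<close> serves both later uses: powers for the moments and indicators for the atom at
  0.\<close>

theorem dirichlet_max_times_gamma:
  fixes h :: "real \<Rightarrow> ennreal"
  assumes a: "0 < a" and b: "0 < b" and n: "1 \<le> n" and [measurable]: "h \<in> borel_measurable borel"
  shows "(\<integral>\<^sup>+x. ennreal (dirichlet_density n a b x) *
            (\<integral>\<^sup>+s. ennreal (gamma_density (real n * a + b) s) * h (s * Max (x ` {1..n})) \<partial>lborel)
          \<partial>Pi\<^sub>M {1..n} (\<lambda>_. lborel)) = (\<integral>\<^sup>+u. h u \<partial>gamma_max_law n a)"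
proof -
  let ?M = "Pi\<^sub>M {1..n} (\<lambda>_. lborel :: real measure)"
  let ?c = "real n * a + b"
  let ?D = "dirichlet_density n a b"
  let ?m = "\<lambda>x::nat \<Rightarrow> real. Max (x ` {1..n})"
  let ?pr = "\<lambda>y. \<Prod>i=1..n. gamma_density a (y i)"
  interpret product_sigma_finite "\<lambda>_::nat. lborel :: real measure" ..
  interpret PF: finite_product_sigma_finite "\<lambda>_::nat. lborel :: real measure" "{1..n}" by standard simp
  interpret P: pair_sigma_finite ?M lborel ..
  have c: "0 < ?c" using a b by (simp add: add_nonneg_pos)
  have pr0: "0 \<le> ?pr y" for y using a by (intro prod_nonneg) (auto intro: gamma_density_nonneg)
  have inner: "(\<integral>\<^sup>+x. ennreal (?D x) * (ennreal (gamma_density ?c s) * h (s * ?m x)) \<partial>?M)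
    = (\<integral>\<^sup>+y. ennreal (?pr y) * ennreal (gamma_density b (s - (\<Sum>i=1..n. y i))) * h (?m y) \<partial>?M)" for s
  proof (cases "0 < s")
    case True
    let ?g = "\<lambda>y. ennreal (gamma_density ?c s) * ennreal (?D (\<lambda>i\<in>{1..n}. y i / s)) * h (?m y)"
    let ?r = "\<lambda>y. ennreal (?pr y) * ennreal (gamma_density b (s - (\<Sum>i=1..n. y i))) * h (?m y)"
    have [measurable]: "(\<lambda>y. \<lambda>i\<in>{1..n}. y i / s) \<in> ?M \<rightarrow>\<^sub>M ?M" by measurable
    have gm: "?g \<in> borel_measurable ?M" by measurable
    have g_scale: "?g (\<lambda>i\<in>{1..n}. s * x i) = ennreal (?D x) * (ennreal (gamma_density ?c s) * h (s * ?m x))"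
      if "x \<in> space ?M" for x
    proof -
      have "(\<lambda>i\<in>{1..n}. (\<lambda>i\<in>{1..n}. s * x i) i / s) = x"
        using that True by (auto simp: fun_eq_iff space_PiM PiE_def extensional_def)
      moreover have "?m (\<lambda>i\<in>{1..n}. s * x i) = s * ?m x"
      proof -
        have "(\<lambda>i\<in>{1..n}. s * x i) ` {1..n} = (\<lambda>u. s * u) ` (x ` {1..n})" by auto
        moreover have "Max ((\<lambda>u. s * u) ` (x ` {1..n})) = s * ?m x"
          using True n by (intro mono_Max_commute[symmetric]) (auto intro!: monoI mult_left_mono)
        ultimately show ?thesis by simp
      qed
      ultimately show ?thesis by (simp add: mult_ac)
    qed
    \<comment> \<open>The factor \<open>s ^ n\<close> appears on both sides, here as the Jacobian
      and below from \<open>dirichlet_gamma_kernel\<close>; being positive and finite it cancels at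
      the end.\<close>
    have "ennreal (s ^ n) * (\<integral>\<^sup>+x. ennreal (?D x) * (ennreal (gamma_density ?c s) * h (s * ?m x)) \<partial>?M)
       = ennreal (s ^ n) * (\<integral>\<^sup>+x. ?g (\<lambda>i\<in>{1..n}. s * x i) \<partial>?M)"
      by (rule arg_cong[where f="\<lambda>z. ennreal (s ^ n) * z"], rule nn_integral_cong, rule g_scale[symmetric])
    also have "\<dots> = (\<integral>\<^sup>+y. ?g y \<partial>?M)"
      using nn_integral_PiM_lborel_scale[OF True _ gm] by simp
    also have "\<dots> = (\<integral>\<^sup>+y. ennreal (s ^ n) * ?r y \<partial>?M)"
    proof (rule nn_integral_cong)
      fix y :: "nat \<Rightarrow> real"
      have "ennreal (gamma_density ?c s) * ennreal (?D (\<lambda>i\<in>{1..n}. y i / s))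
        = ennreal (s ^ n * (?pr y * gamma_density b (s - (\<Sum>i=1..n. y i))))"
        unfolding dirichlet_gamma_kernel[OF a b True, symmetric]
        by (intro ennreal_mult[symmetric] gamma_density_nonneg dirichlet_density_nonneg c a b)
      also have "\<dots> = ennreal (s ^ n) * (ennreal (?pr y) * ennreal (gamma_density b (s - (\<Sum>i=1..n. y i))))"
        using True pr0[of y] gamma_density_nonneg[OF b] by (simp add: ennreal_mult)
      finally show "?g y = ennreal (s ^ n) * ?r y" by (simp add: mult.assoc)
    qed
    also have "\<dots> = ennreal (s ^ n) * (\<integral>\<^sup>+y. ?r y \<partial>?M)"
      by (rule nn_integral_cmult) measurable
    finally show ?thesis
      using True by (simp add: ennreal_mult_cancel_left)
  next
    case False
    \<comment> \<open>For s <= 0 the left side vanishes through the density of the total. On the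
      right, either some coordinate is not positive, or the sum is nonnegative and the remainder is
      not positive.\<close>
    have "?pr y * gamma_density b (s - (\<Sum>i=1..n. y i)) = 0" for y :: "nat \<Rightarrow> real"
    proof (cases "\<forall>i\<in>{1..n}. 0 < y i")
      case True
      hence "0 \<le> (\<Sum>i=1..n. y i)" by (intro sum_nonneg) (auto simp: less_imp_le)
      thus ?thesis using False by simp
    next
      case False
      then obtain i where "i \<in> {1..n}" "gamma_density a (y i) = 0" by (auto simp: not_less)
      hence "?pr y = 0" by (intro prod_zero) auto
      thus ?thesis by simp
    qed
    hence z: "ennreal (?pr y) * ennreal (gamma_density b (s - (\<Sum>i=1..n. y i))) = 0" for y :: "nat \<Rightarrow> real"
      by (metis ennreal_0 ennreal_mult' mult_zero_left pr0)
    show ?thesis unfolding z using False by simp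
  qed
  have "(\<integral>\<^sup>+x. ennreal (?D x) * (\<integral>\<^sup>+s. ennreal (gamma_density ?c s) * h (s * ?m x) \<partial>lborel) \<partial>?M)
     = (\<integral>\<^sup>+x. (\<integral>\<^sup>+s. ennreal (?D x) * (ennreal (gamma_density ?c s) * h (s * ?m x)) \<partial>lborel) \<partial>?M)"
    by (intro nn_integral_cong nn_integral_cmult[symmetric]) measurable
  also have "\<dots> = (\<integral>\<^sup>+s. (\<integral>\<^sup>+x. ennreal (?D x) * (ennreal (gamma_density ?c s) * h (s * ?m x)) \<partial>?M) \<partial>lborel)"
    by (intro P.Fubini'[symmetric]) measurable
  also have "\<dots> = (\<integral>\<^sup>+s. (\<integral>\<^sup>+y. ennreal (?pr y) * ennreal (gamma_density b (s - (\<Sum>i=1..n. y i))) * h (?m y) \<partial>?M) \<partial>lborel)"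
    by (simp only: inner)
  also have "\<dots> = (\<integral>\<^sup>+y. (\<integral>\<^sup>+s. ennreal (?pr y) * ennreal (gamma_density b (s - (\<Sum>i=1..n. y i))) * h (?m y) \<partial>lborel) \<partial>?M)"
    by (intro P.Fubini') measurable
  also have "\<dots> = (\<integral>\<^sup>+y. (\<Prod>i=1..n. ennreal (gamma_density a (y i))) * h (?m y) \<partial>?M)"
  proof (rule nn_integral_cong)
    fix y :: "nat \<Rightarrow> real"
    let ?S = "\<Sum>i=1..n. y i"
    have "(\<integral>\<^sup>+s. ennreal (?pr y) * ennreal (gamma_density b (s - ?S)) * h (?m y) \<partial>lborel)
      = ennreal (?pr y) * (\<integral>\<^sup>+s. ennreal (gamma_density b (s - ?S)) \<partial>lborel) * h (?m y)"
      by (simp add: nn_integral_cmult nn_integral_multc)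
    \<comment> \<open>Only the remainder depends on \<open>s\<close>; translation invariance reduces
      its integral to the total mass of a Gamma law.\<close>
    also have "(\<integral>\<^sup>+s. ennreal (gamma_density b (s - ?S)) \<partial>lborel) = (\<integral>\<^sup>+s. ennreal (gamma_density b s) \<partial>lborel)"
      by (subst (2) nn_integral_real_affine[where c=1 and t="- ?S"]) auto
    also have "\<dots> = 1" using b by (rule nn_integral_gamma_density)
    finally show "(\<integral>\<^sup>+s. ennreal (?pr y) * ennreal (gamma_density b (s - ?S)) * h (?m y) \<partial>lborel)
      = (\<Prod>i=1..n. ennreal (gamma_density a (y i))) * h (?m y)"
      using gamma_density_nonneg[OF a] by (simp add: prod_ennreal)
  qed
  also have "\<dots> = (\<integral>\<^sup>+u. h u \<partial>gamma_max_law n a)"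
    by (rule nn_integral_gamma_max_law[symmetric]) measurable
  finally show ?thesis .
qed


section \<open>The distribution with distribution function \<open>F_cdf a\<close>\<close>

lemma borel_measurable_exp_int [measurable]: "exp_int \<in> borel_measurable borel"
proof -
  have "exp_int = (\<lambda>x. LBINT u. (if x < u then exp (- u) / u else 0))"
    unfolding exp_int_def set_lebesgue_integral_def
    by (intro ext Bochner_Integration.integral_cong) (auto split: split_indicator)
  also have "\<dots> \<in> borel_measurable borel" by measurable
  finally show ?thesis .
qed

text \<open>Near \<open>x\<close> the tail integral is a constant minus an integral over a compact
  interval, to which the fundamental theorem of calculus applies. The window from x/2 to 2 * x keeps
  away from the singularity at 0.\<close>

lemma DERIV_exp_int:
  assumes x: "0 < x"
  shows "(exp_int has_real_derivative - (exp (- x) / x)) (at x)"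
proof -
  let ?a = "x / 2" and ?b = "2 * x" and ?f = "\<lambda>u::real. exp (- u) / u"
  have eq: "exp_int y = exp_int ?a - integral {?a..y} ?f" if "y \<in> {?a<..<?b}" for y
  proof -
    \<comment> \<open>Starting at \<open>?a/2\<close> makes the open half-line contain the closed
      endpoint \<open>?a\<close>.\<close>
    have "set_integrable lborel {?a/2<..} ?f" using x by (intro set_integrable_exp_int) auto
    hence i: "set_integrable lborel {?a..y} ?f" by (rule set_integrable_subset) (use x in auto)
    have "(LBINT u:{?a<..y}. ?f u) = (LBINT u:{?a..y}. ?f u)"
      unfolding set_lebesgue_integral_def
      by (rule integral_cong_AE)
         (use AE_lborel_singleton[of ?a] in \<open>auto elim!: eventually_mono split: split_indicator\<close>)
    also have "\<dots> = integral {?a..y} ?f" using set_borel_integral_eq_integral(2)[OF i] .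
    finally show ?thesis using exp_int_split[of ?a y] x that by simp
  qed
  have "((\<lambda>y. integral {?a..y} ?f) has_real_derivative ?f x) (at x within {?a..?b})"
    using x by (intro integral_has_real_derivative) (auto intro!: continuous_intros)
  hence "((\<lambda>y. integral {?a..y} ?f) has_real_derivative ?f x) (at x)"
    using x by (simp add: at_within_Icc_at)
  hence "((\<lambda>y. exp_int ?a - integral {?a..y} ?f) has_real_derivative - ?f x) (at x)"
    by (auto intro!: derivative_eq_intros)
  thus ?thesis
    by (rule has_field_derivative_transform_within_open[where S="{?a<..<?b}"]) (use x eq in auto)
qed

definition F_density :: "real \<Rightarrow> real \<Rightarrow> real" where
  "F_density a x = (if 0 < x then a * exp (- x - a * exp_int x) / x else 0)"

lemma borel_measurable_F_density [measurable]: "F_density a \<in> borel_measurable borel"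
  unfolding F_density_def[abs_def] by measurable

lemma F_density_nonneg: "0 < a \<Longrightarrow> 0 \<le> F_density a x"
  by (simp add: F_density_def)

lemma DERIV_F_cdf:
  assumes x: "0 < x"
  shows "(F_cdf a has_real_derivative F_density a x) (at x)"
proof -
  have "((\<lambda>x. exp (- a * exp_int x)) has_real_derivative F_density a x) (at x)"
    using x by (auto intro!: derivative_eq_intros DERIV_exp_int simp: F_density_def exp_diff exp_minus field_simps)
  thus ?thesis
    by (rule has_field_derivative_transform_within_open[where S="{0<..}"]) (use x in \<open>auto simp: F_cdf_def\<close>)
qed

lemma nn_integral_F_density_tail:
  assumes a: "0 < a" and x: "0 < x"
  shows "(\<integral>\<^sup>+u. ennreal (F_density a u) * indicator {x<..} u \<partial>lborel) = ennreal (1 - F_cdf a x)"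
proof -
  have "(\<integral>\<^sup>+u. ennreal (F_density a u) * indicator {x<..} u \<partial>lborel) = (\<integral>\<^sup>+u. ennreal (F_density a u) * indicator {x..} u \<partial>lborel)"
    by (rule nn_integral_cong_AE) (use AE_lborel_singleton[of x] in \<open>auto elim!: eventually_mono split: split_indicator\<close>)
  also have "\<dots> = ennreal (1 - F_cdf a x)"
    using a x by (intro nn_integral_FTC_atLeast DERIV_F_cdf F_cdf_at_top F_density_nonneg) auto
  finally show ?thesis .
qed

lemma sets_F_distribution [simp, measurable_cong]: "sets (F_distribution a) = sets borel"
  and space_F_distribution [simp]: "space (F_distribution a) = UNIV"
  by (simp_all add: F_distribution_def)

lemma AE_F_distribution_pos:
  assumes "0 < a"
  shows "AE x in F_distribution a. 0 < x"
proof -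
  interpret real_distribution "F_distribution a" by (rule real_distribution_F_distribution) fact
  have "prob {..0} = 0"
    using cdf_F_distribution[OF assms] by (simp add: cdf_def F_cdf_def fun_eq_iff)
  hence "{..0} \<in> null_sets (F_distribution a)"
    by (auto intro!: null_setsI simp: emeasure_eq_measure)
  thus ?thesis by (rule AE_I'[where N="{..0}"]) auto
qed

lemma nn_integral_power_F_distribution_tails:
  assumes a: "0 < a" and k: "1 \<le> k"
  shows "(\<integral>\<^sup>+x. ennreal (x ^ k) \<partial>F_distribution a) =
    (\<integral>\<^sup>+t. ennreal (k * t ^ (k - 1)) * indicator {0<..} t * ennreal (1 - F_cdf a t) \<partial>lborel)"
proof -
  interpret F: real_distribution "F_distribution a" by (rule real_distribution_F_distribution) fact
  have tail: "emeasure (F_distribution a) {x \<in> space (F_distribution a). t < x} = ennreal (1 - F_cdf a t)" for t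
  proof -
    have "{x \<in> space (F_distribution a). t < x} = space (F_distribution a) - {..t}" by auto
    thus ?thesis using F.prob_compl[of "{..t}"] cdf_F_distribution[OF a]
      by (simp add: F.emeasure_eq_measure cdf_def fun_eq_iff)
  qed
  show ?thesis
    unfolding tail[symmetric] using AE_F_distribution_pos[OF a] k
    by (intro nn_integral_power_eq_tails F.sigma_finite_measure_axioms) (auto elim!: eventually_mono)
qed

text \<open>The measure with density \<open>F_density a\<close> has the same tails
  \<open>1 - F_cdf a t\<close> for t > 0. Using the layer-cake formula forwards for one measure and
  backwards for the other equates their moments without identifying the measures.\<close>

lemma nn_integral_power_F_distribution:
  assumes a: "0 < a" and k: "1 \<le> k"
  shows "(\<integral>\<^sup>+x. ennreal (x ^ k) \<partial>F_distribution a) =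
    (\<integral>\<^sup>+x. ennreal (a * (x ^ (k - 1) * exp (- x - a * exp_int x))) * indicator {0<..} x \<partial>lborel)"
proof -
  let ?D = "density lborel (\<lambda>x. ennreal (F_density a x))"
  have sf: "sigma_finite_measure ?D"
    by (subst sigma_finite_measure.sigma_finite_iff_density_finite[OF sigma_finite_lborel]) auto
  have "(\<integral>\<^sup>+x. ennreal (x ^ k) \<partial>F_distribution a) =
      (\<integral>\<^sup>+t. ennreal (k * t ^ (k - 1)) * indicator {0<..} t * ennreal (1 - F_cdf a t) \<partial>lborel)"
    by (rule nn_integral_power_F_distribution_tails) fact+
  also have "\<dots> = (\<integral>\<^sup>+t. ennreal (k * t ^ (k - 1)) * indicator {0<..} t * emeasure ?D {x\<in>space ?D. t < x} \<partial>lborel)"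
  proof (rule nn_integral_cong)
    fix t :: real
    have "emeasure ?D {x\<in>space ?D. t < x} = (\<integral>\<^sup>+u. ennreal (F_density a u) * indicator {t<..} u \<partial>lborel)"
      by (subst emeasure_density) (auto simp: greaterThan_def)
    thus "ennreal (k * t ^ (k - 1)) * indicator {0<..} t * ennreal (1 - F_cdf a t)
       = ennreal (k * t ^ (k - 1)) * indicator {0<..} t * emeasure ?D {x\<in>space ?D. t < x}"
      using nn_integral_F_density_tail[OF a] by (cases "0 < t") auto
  qed
  also have "\<dots> = (\<integral>\<^sup>+x. ennreal (x ^ k) \<partial>?D)"
    using k by (intro nn_integral_power_eq_tails[symmetric] sf)
               (auto simp: AE_density F_density_def)
  also have "\<dots> = (\<integral>\<^sup>+x. ennreal (a * (x ^ (k - 1) * exp (- x - a * exp_int x))) * indicator {0<..} x \<partial>lborel)"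
  proof (subst nn_integral_density, simp, simp, rule nn_integral_cong)
    fix x :: real
    have "x ^ k = x * x ^ (k - 1)" using k by (metis power_eq_if not_one_le_zero)
    thus "ennreal (F_density a x) * ennreal (x ^ k) =
      ennreal (a * (x ^ (k - 1) * exp (- x - a * exp_int x))) * indicator {0<..} x"
      using a by (cases "0 < x") (auto simp: F_density_def ennreal_mult'[symmetric] mult_ac)
  qed
  finally show ?thesis .
qed

lemma gamma_density_1: "gamma_density 1 u = (if 0 < u then exp (- u) else 0)"
  by (simp add: gamma_density_def)

text \<open>Since \<open>exp_int\<close> is nonnegative on the positive axis, the integrand is at
  most x^k * exp (- x), a Gamma moment.\<close>

lemma set_integrable_power_F:
  assumes a: "0 < a"
  shows "set_integrable lborel {0<..} (\<lambda>x. x ^ k * exp (- x - a * exp_int x))"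
  unfolding set_integrable_def
proof (rule integrableI_bounded)
  show "(\<lambda>x. indicat_real {0<..} x *\<^sub>R (x ^ k * exp (- x - a * exp_int x))) \<in> borel_measurable lborel"
    by measurable
  have "(\<integral>\<^sup>+x. ennreal (norm (indicat_real {0<..} x *\<^sub>R (x ^ k * exp (- x - a * exp_int x)))) \<partial>lborel)
    \<le> (\<integral>\<^sup>+x. ennreal (gamma_density 1 x) * ennreal (x ^ k) \<partial>lborel)"
    using a by (intro nn_integral_mono)
     (auto simp: gamma_density_1 ennreal_mult'[symmetric] mult.commute intro!: ennreal_leI mult_right_mono mult_nonneg_nonneg exp_int_nonneg split: split_indicator)
  also have "\<dots> < \<infinity>" by (subst nn_integral_gamma_density_power) auto
  finally show "(\<integral>\<^sup>+x. ennreal (norm (indicat_real {0<..} x *\<^sub>R (x ^ k * exp (- x - a * exp_int x)))) \<partial>lborel) < \<infinity>" .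
qed

lemma has_bochner_integral_power_F_distribution:
  assumes a: "0 < a" and k: "1 \<le> k"
  shows "has_bochner_integral (F_distribution a) (\<lambda>x. x ^ k)
     (a * (LBINT x:{0<..}. x ^ (k - 1) * exp (- x - a * exp_int x)))"
proof (rule has_bochner_integral_nn_integral)
  let ?f = "\<lambda>x. x ^ (k - 1) * exp (- x - a * exp_int x)"
  show "AE x in F_distribution a. 0 \<le> x ^ k"
    using AE_F_distribution_pos[OF a] by eventually_elim simp
  show nn: "0 \<le> a * (LBINT x:{0<..}. ?f x)"
    using a unfolding set_lebesgue_integral_def
    by (intro mult_nonneg_nonneg integral_nonneg_AE) (auto split: split_indicator)
  have "(\<integral>\<^sup>+x. ennreal (x ^ k) \<partial>F_distribution a) =
     (\<integral>\<^sup>+x. ennreal (indicat_real {0<..} x *\<^sub>R (a * ?f x)) \<partial>lborel)"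
    unfolding nn_integral_power_F_distribution[OF a k]
    by (intro nn_integral_cong) (auto split: split_indicator)
  also have "\<dots> = ennreal (LBINT x:{0<..}. a * ?f x)"
    unfolding set_lebesgue_integral_def
    using a set_integrable_power_F[OF a, of "k - 1"]
    by (intro nn_integral_eq_integral) (auto simp: set_integrable_def mult.left_commute split: split_indicator)
  finally show "(\<integral>\<^sup>+x. ennreal (x ^ k) \<partial>F_distribution a) = ennreal (a * (LBINT x:{0<..}. ?f x))" by simp
qed simp


section \<open>The maximum of independent Gamma variables\<close>

lemma sets_gamma_distribution [simp, measurable_cong]: "sets (gamma_distribution d) = sets borel"
  and space_gamma_distribution [simp]: "space (gamma_distribution d) = UNIV"
  by (simp_all add: gamma_distribution_def)

lemma emeasure_gamma_distribution:
  "A \<in> sets borel \<Longrightarrow> emeasure (gamma_distribution d) A = (\<integral>\<^sup>+u. ennreal (gamma_density d u) * indicator A u \<partial>lborel)"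
  by (simp add: gamma_distribution_def emeasure_density)

lemma nn_integral_gamma_distribution:
  assumes [measurable]: "h \<in> borel_measurable borel"
  shows "(\<integral>\<^sup>+u. h u \<partial>gamma_distribution d) = (\<integral>\<^sup>+u. ennreal (gamma_density d u) * h u \<partial>lborel)"
  by (simp add: gamma_distribution_def nn_integral_density)

lemma real_distribution_gamma_distribution: "0 < d \<Longrightarrow> real_distribution (gamma_distribution d)"
  unfolding real_distribution_def real_distribution_axioms_def
  by (auto intro!: prob_spaceI simp: emeasure_gamma_distribution nn_integral_gamma_density)

lemma real_distribution_gamma_max_law: "0 < a \<Longrightarrow> real_distribution (gamma_max_law n a)"
  unfolding real_distribution_def real_distribution_axioms_def
  by (auto intro!: prob_space_gamma_max_law)

text \<open>Writing the base through the upper tail isolates the small quantity whose n-fold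
  multiple has a limit.\<close>

lemma prob_gamma_max_law_atMost:
  assumes a: "0 < a" and n: "1 \<le> n"
  shows "measure (gamma_max_law n a) {..x} = (1 - measure (gamma_distribution a) {x<..}) ^ n"
proof -
  interpret G: real_distribution "gamma_distribution a" by (rule real_distribution_gamma_distribution) fact
  interpret M: real_distribution "gamma_max_law n a" by (rule real_distribution_gamma_max_law) fact
  have "space (gamma_distribution a) - {x<..} = {..x}" by auto
  hence "G.prob {..x} = 1 - G.prob {x<..}" using G.prob_compl[of "{x<..}"] by simp
  thus ?thesis
    using emeasure_gamma_max_law_atMost[OF n, of a x]
    by (simp add: M.emeasure_eq_measure G.emeasure_eq_measure emeasure_gamma_distribution[symmetric] ennreal_power)
qed

lemma tendsto_0_of_tendsto_n_times:
  fixes r :: "nat \<Rightarrow> real"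
  assumes "(\<lambda>n. real n * r n) \<longlonglongrightarrow> L"
  shows "r \<longlonglongrightarrow> 0"
proof -
  have "(\<lambda>n. (real n * r n) * inverse (real n)) \<longlonglongrightarrow> L * 0"
    by (intro tendsto_intros assms lim_inverse_n)
  hence "(\<lambda>n. (real n * r n) * inverse (real n)) \<longlonglongrightarrow> 0" by simp
  thus ?thesis
    by (rule Lim_transform_eventually) (use eventually_gt_at_top[of 0] in \<open>eventually_elim, simp\<close>)
qed

text \<open>Take logarithms: for 0 <= r <= 1/2 the error of replacing ln (1 - r) by - r is at most 2
  * r^2, and n * r^2 = (n * r) * r tends to 0.\<close>

lemma tendsto_one_minus_power_exp:
  fixes r :: "nat \<Rightarrow> real"
  assumes lim: "(\<lambda>n. real n * r n) \<longlonglongrightarrow> L" and nonneg: "\<And>n. 1 \<le> n \<Longrightarrow> 0 \<le> r n"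
  shows "(\<lambda>n. (1 - r n) ^ n) \<longlonglongrightarrow> exp (- L)"
proof -
  have r0: "r \<longlonglongrightarrow> 0" by (rule tendsto_0_of_tendsto_n_times[OF lim])
  have "(\<lambda>n. real n * ln (1 - r n) + real n * r n) \<longlonglongrightarrow> 0"
  proof (rule Lim_null_comparison)
    have "(\<lambda>n. 2 * ((real n * r n) * r n)) \<longlonglongrightarrow> 2 * (L * 0)"
      by (intro tendsto_intros lim r0)
    thus "(\<lambda>n. 2 * ((real n * r n) * r n)) \<longlonglongrightarrow> 0" by simp
    have "\<forall>\<^sub>F n in sequentially. r n < 1/2" using r0 by (rule order_tendstoD) simp
    thus "\<forall>\<^sub>F n in sequentially. norm (real n * ln (1 - r n) + real n * r n) \<le> 2 * ((real n * r n) * r n)"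
      using eventually_ge_at_top[of 1]
    proof eventually_elim
      case (elim n)
      have "\<bar>ln (1 + (- r n)) - (- r n)\<bar> \<le> 2 * (- r n)\<^sup>2"
        using elim nonneg[of n] by (intro abs_ln_one_plus_x_minus_x_bound_nonpos) auto
      hence "real n * \<bar>ln (1 - r n) + r n\<bar> \<le> real n * (2 * (r n)\<^sup>2)"
        by (intro mult_left_mono) auto
      thus ?case by (simp add: distrib_left[symmetric] abs_mult power2_eq_square mult_ac)
    qed
  qed
  from tendsto_diff[OF this lim] have "(\<lambda>n. real n * ln (1 - r n)) \<longlonglongrightarrow> - L" by simp
  hence "(\<lambda>n. exp (real n * ln (1 - r n))) \<longlonglongrightarrow> exp (- L)" by (rule tendsto_exp)
  moreover have "\<forall>\<^sub>F n in sequentially. r n < 1" using r0 by (rule order_tendstoD) simp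
  hence "\<forall>\<^sub>F n in sequentially. exp (real n * ln (1 - r n)) = (1 - r n) ^ n"
    by eventually_elim (simp add: exp_of_nat_mult)
  ultimately show ?thesis by (rule Lim_transform_eventually)
qed

section \<open>Asymptotics of the Gamma maximum when \<open>n * a n\<close> tends to
  \<alpha>\<close>

context
  fixes a :: "nat \<Rightarrow> real" and \<alpha> :: real
  assumes a_pos: "\<And>n. 1 \<le> n \<Longrightarrow> 0 < a n" and a_lim: "(\<lambda>n. real n * a n) \<longlonglongrightarrow> \<alpha>" and \<alpha>: "0 < \<alpha>"
begin

lemma a_tendsto_0: "a \<longlonglongrightarrow> 0"
  by (rule tendsto_0_of_tendsto_n_times[OF a_lim])

text \<open>The functional equation gives 1 / Gamma z = z / Gamma (z + 1), and Gamma (z + 1) tends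
  to 1 as z tends to 0.\<close>

lemma tendsto_n_over_Gamma: "(\<lambda>n. real n / Gamma (a n)) \<longlonglongrightarrow> \<alpha>"
proof -
  have "(\<lambda>n. Gamma (a n + 1)) \<longlonglongrightarrow> Gamma (0 + 1)"
    by (intro tendsto_Gamma tendsto_intros a_tendsto_0) auto
  hence "(\<lambda>n. (real n * a n) / Gamma (a n + 1)) \<longlonglongrightarrow> \<alpha> / 1"
    by (intro tendsto_divide a_lim) auto
  hence "(\<lambda>n. (real n * a n) / Gamma (a n + 1)) \<longlonglongrightarrow> \<alpha>" by simp
  moreover have "\<forall>\<^sub>F n in sequentially. (real n * a n) / Gamma (a n + 1) = real n / Gamma (a n)"
    using eventually_ge_at_top[of 1]
  proof eventually_elim
    case (elim n)
    hence "Gamma (a n + 1) = a n * Gamma (a n)"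
      using a_pos[of n] by (intro Gamma_plus1) (auto elim!: nonpos_Ints_cases)
    thus ?case using a_pos[of n] elim by simp
  qed
  ultimately show ?thesis by (rule Lim_transform_eventually)
qed

text \<open>A bound for \<open>n * gamma_density (a n) u\<close>, valid for all large n at once: the
  constant \<alpha> + 1 eventually exceeds \<open>n / Gamma (a n)\<close>, and for 0 < a n < 1 the
  power u^(a n - 1) is at most 1/u when u <= 1 and at most 1 otherwise.\<close>

definition envelope :: "real \<Rightarrow> real" where
  "envelope u = (if 0 < u then (\<alpha> + 1) * ((1 / u + 1) * exp (- u)) else 0)"

lemma borel_measurable_envelope [measurable]: "envelope \<in> borel_measurable borel"
  unfolding envelope_def[abs_def] by measurable

lemma gamma_density_le_envelope:
  "\<forall>\<^sub>F n in sequentially. \<forall>u. real n * gamma_density (a n) u \<le> envelope u"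
proof -
  have "\<forall>\<^sub>F n in sequentially. real n / Gamma (a n) < \<alpha> + 1"
    using tendsto_n_over_Gamma by (rule order_tendstoD) simp
  moreover have "\<forall>\<^sub>F n in sequentially. a n < 1"
    using a_tendsto_0 by (rule order_tendstoD) simp
  ultimately show ?thesis using eventually_ge_at_top[of 1]
  proof eventually_elim
    case (elim n)
    show ?case
    proof
      fix u :: real
      show "real n * gamma_density (a n) u \<le> envelope u"
      proof (cases "0 < u")
        case True
        have "u powr (a n - 1) \<le> 1 / u + 1"
        proof (cases "u \<le> 1")
          case True
          have "u powr (a n - 1) \<le> u powr (-1)"
            using \<open>0 < u\<close> True a_pos[of n] elim by (intro powr_mono') auto
          thus ?thesis using \<open>0 < u\<close> by (simp add: powr_minus_divide)
        next
          case False
          have "u powr (a n - 1) \<le> u powr 0" using False elim by (intro powr_mono) auto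
          also have "\<dots> \<le> 1 / u + 1" using \<open>0 < u\<close> by simp
          finally show ?thesis .
        qed
        hence "(real n / Gamma (a n)) * (u powr (a n - 1) * exp (- u)) \<le> (\<alpha> + 1) * ((1 / u + 1) * exp (- u))"
          using elim \<alpha> True by (intro mult_mono mult_right_mono) auto
        thus ?thesis using True by (simp add: gamma_density_def envelope_def)
      qed (simp add: envelope_def)
    qed
  qed
qed

lemma nn_integral_envelope_tail_finite:
  assumes x: "0 < x"
  shows "(\<integral>\<^sup>+u. ennreal (envelope u) * indicator {x<..} u \<partial>lborel) < \<infinity>"
proof -
  have "(\<integral>\<^sup>+u. ennreal (envelope u) * indicator {x<..} u \<partial>lborel)
     \<le> (\<integral>\<^sup>+u. ennreal ((\<alpha> + 1) * (1 / x + 1)) * ennreal (gamma_density 1 u) \<partial>lborel)"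
  proof (rule nn_integral_mono)
    fix u :: real
    show "ennreal (envelope u) * indicator {x<..} u \<le> ennreal ((\<alpha> + 1) * (1 / x + 1)) * ennreal (gamma_density 1 u)"
    proof (cases "x < u")
      case True
      hence "(\<alpha> + 1) * ((1 / u + 1) * exp (- u)) \<le> (\<alpha> + 1) * ((1 / x + 1) * exp (- u))"
        using x \<alpha> by (intro mult_left_mono mult_right_mono add_right_mono divide_left_mono) auto
      thus ?thesis using True x \<alpha>
        by (simp add: envelope_def gamma_density_1 ennreal_mult'[symmetric] ennreal_leI mult.assoc)
    qed simp
  qed
  also have "\<dots> = ennreal ((\<alpha> + 1) * (1 / x + 1))"
    by (simp add: nn_integral_cmult nn_integral_gamma_density)
  finally show ?thesis by (rule order.strict_trans1) simp
qed

text \<open>One factor u absorbs the singularity 1/u, leaving two moments of the standard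
  exponential law; this is where \<open>1 \<le> k\<close> is essential.\<close>

lemma nn_integral_envelope_power_finite:
  assumes k: "1 \<le> k"
  shows "(\<integral>\<^sup>+u. ennreal (envelope u) * ennreal (u ^ k) \<partial>lborel) < \<infinity>"
proof -
  have "(\<integral>\<^sup>+u. ennreal (envelope u) * ennreal (u ^ k) \<partial>lborel) =
    (\<integral>\<^sup>+u. ennreal (\<alpha> + 1) * (ennreal (gamma_density 1 u) * ennreal (u ^ (k - 1)) + ennreal (gamma_density 1 u) * ennreal (u ^ k)) \<partial>lborel)"
  proof (rule nn_integral_cong)
    fix u :: real
    show "ennreal (envelope u) * ennreal (u ^ k) =
      ennreal (\<alpha> + 1) * (ennreal (gamma_density 1 u) * ennreal (u ^ (k - 1)) + ennreal (gamma_density 1 u) * ennreal (u ^ k))"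
    proof (cases "0 < u")
      case True
      obtain j where j: "k = Suc j" using k by (cases k) auto
      have "envelope u * u ^ k = (\<alpha> + 1) * (gamma_density 1 u * u ^ (k - 1) + gamma_density 1 u * u ^ k)"
        using True by (simp add: j envelope_def gamma_density_1 field_simps)
      thus ?thesis using True \<alpha>
        by (simp add: ennreal_mult'[symmetric] ennreal_plus[symmetric] gamma_density_nonneg envelope_def gamma_density_1 del: ennreal_plus)
    qed (simp add: envelope_def gamma_density_1)
  qed
  also have "\<dots> = ennreal (\<alpha> + 1) * (ennreal (Gamma (1 + real (k - 1)) / Gamma 1) + ennreal (Gamma (1 + real k) / Gamma 1))"
    by (subst nn_integral_cmult, simp, subst nn_integral_add, simp, simp, subst (1 2) nn_integral_gamma_density_power, simp_all)
  also have "\<dots> < \<infinity>" by (simp add: ennreal_mult_less_top)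
  finally show ?thesis .
qed

lemma emeasure_gamma_tail_le_envelope:
  "\<forall>\<^sub>F n in sequentially. \<forall>x. ennreal (real n * measure (gamma_distribution (a n)) {x<..}) \<le>
      (\<integral>\<^sup>+u. ennreal (envelope u) * indicator {x<..} u \<partial>lborel)"
  using gamma_density_le_envelope eventually_ge_at_top[of 1]
proof eventually_elim
  case (elim n)
  interpret G: real_distribution "gamma_distribution (a n)"
    by (rule real_distribution_gamma_distribution) (use elim a_pos in auto)
  show ?case
  proof
    fix x :: real
    have "ennreal (real n * G.prob {x<..}) = ennreal (real n) * emeasure (gamma_distribution (a n)) {x<..}"
      by (simp add: G.emeasure_eq_measure ennreal_mult)
    also have "\<dots> = (\<integral>\<^sup>+u. ennreal (real n) * (ennreal (gamma_density (a n) u) * indicator {x<..} u) \<partial>lborel)"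
      by (subst emeasure_gamma_distribution) (auto simp: nn_integral_cmult)
    also have "\<dots> \<le> (\<integral>\<^sup>+u. ennreal (envelope u) * indicator {x<..} u \<partial>lborel)"
      using elim by (intro nn_integral_mono) (auto simp: ennreal_mult'[symmetric] mult.assoc[symmetric] ennreal_leI split: split_indicator)
    finally show "ennreal (real n * G.prob {x<..}) \<le> (\<integral>\<^sup>+u. ennreal (envelope u) * indicator {x<..} u \<partial>lborel)" .
  qed
qed

lemma tendsto_gamma_tail:
  assumes x: "0 < x"
  shows "(\<lambda>n. real n * measure (gamma_distribution (a n)) {x<..}) \<longlonglongrightarrow> \<alpha> * exp_int x"
proof -
  \<comment> \<open>The domination holds only from \<open>N\<close> on, so the sequence is shifted.
    The shift by \<open>Suc N\<close> also keeps the index at least 1, where \<open>a\<close> is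
    known to be positive.\<close>
  obtain N where N: "\<And>n u. N \<le> n \<Longrightarrow> real n * gamma_density (a n) u \<le> envelope u"
    using gamma_density_le_envelope unfolding eventually_sequentially by blast
  let ?f = "\<lambda>n u. ennreal (real (n + Suc N) * gamma_density (a (n + Suc N)) u) * indicator {x<..} u"
  have "(\<lambda>n. \<integral>\<^sup>+u. ?f n u \<partial>lborel) \<longlonglongrightarrow> (\<integral>\<^sup>+u. ennreal (\<alpha> * (exp (- u) / u)) * indicator {x<..} u \<partial>lborel)"
  proof (rule nn_integral_dominated_convergence[where w="\<lambda>u. ennreal (envelope u) * indicator {x<..} u"])
    show "AE u in lborel. ?f n u \<le> ennreal (envelope u) * indicator {x<..} u" for n
      using N[of "n + Suc N"] by (intro AE_I2) (auto intro!: ennreal_leI split: split_indicator)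
    show "(\<integral>\<^sup>+u. ennreal (envelope u) * indicator {x<..} u \<partial>lborel) < \<infinity>"
      by (rule nn_integral_envelope_tail_finite) fact
    show "AE u in lborel. (\<lambda>n. ?f n u) \<longlonglongrightarrow> ennreal (\<alpha> * (exp (- u) / u)) * indicator {x<..} u"
    proof (intro AE_I2)
      fix u :: real
      show "(\<lambda>n. ?f n u) \<longlonglongrightarrow> ennreal (\<alpha> * (exp (- u) / u)) * indicator {x<..} u"
      proof (cases "x < u")
        case True
        hence u: "0 < u" using x by simp
        have "(\<lambda>n. (real n / Gamma (a n)) * (u powr (a n - 1) * exp (- u))) \<longlonglongrightarrow> \<alpha> * (u powr (0 - 1) * exp (- u))"
          using u by (intro tendsto_intros tendsto_n_over_Gamma a_tendsto_0) auto
        hence "(\<lambda>n. real n * gamma_density (a n) u) \<longlonglongrightarrow> \<alpha> * (exp (- u) / u)"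
          using u by (simp add: gamma_density_def powr_minus_divide)
        hence "(\<lambda>n. ennreal (real n * gamma_density (a n) u)) \<longlonglongrightarrow> ennreal (\<alpha> * (exp (- u) / u))"
          by (rule tendsto_ennrealI)
        from LIMSEQ_ignore_initial_segment[OF this, of "Suc N"] True show ?thesis by simp
      qed simp
    qed
  qed measurable
  also have "(\<lambda>n. \<integral>\<^sup>+u. ?f n u \<partial>lborel) =
     (\<lambda>n. ennreal (real (n + Suc N) * measure (gamma_distribution (a (n + Suc N))) {x<..}))"
  proof
    fix n
    let ?m = "n + Suc N"
    interpret G: real_distribution "gamma_distribution (a ?m)"
      by (rule real_distribution_gamma_distribution) (use a_pos in auto)
    have "(\<integral>\<^sup>+u. ?f n u \<partial>lborel) = (\<integral>\<^sup>+u. ennreal (real ?m) * (ennreal (gamma_density (a ?m) u) * indicator {x<..} u) \<partial>lborel)"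
      by (simp only: ennreal_mult'[OF of_nat_0_le_iff] mult.assoc)
    also have "\<dots> = ennreal (real ?m) * emeasure (gamma_distribution (a ?m)) {x<..}"
      by (subst emeasure_gamma_distribution, simp, rule nn_integral_cmult, measurable)
    finally show "(\<integral>\<^sup>+u. ?f n u \<partial>lborel) = ennreal (real ?m * G.prob {x<..})"
      by (simp only: G.emeasure_eq_measure ennreal_mult'[OF of_nat_0_le_iff])
  qed
  also have "(\<integral>\<^sup>+u. ennreal (\<alpha> * (exp (- u) / u)) * indicator {x<..} u \<partial>lborel) = ennreal (\<alpha> * exp_int x)"
  proof -
    have "(\<integral>\<^sup>+u. ennreal (\<alpha> * (exp (- u) / u)) * indicator {x<..} u \<partial>lborel) =
      (\<integral>\<^sup>+u. ennreal (indicat_real {x<..} u *\<^sub>R (\<alpha> * (exp (- u) / u))) \<partial>lborel)"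
      by (intro nn_integral_cong) (auto split: split_indicator)
    also have "\<dots> = ennreal (LBINT u:{x<..}. \<alpha> * (exp (- u) / u))"
      unfolding set_lebesgue_integral_def
      using set_integrable_mult_right[OF set_integrable_exp_int[OF x], of \<alpha>] \<alpha> x unfolding set_integrable_def
      by (intro nn_integral_eq_integral) (auto split: split_indicator)
    also have "(LBINT u:{x<..}. \<alpha> * (exp (- u) / u)) = \<alpha> * exp_int x"
      unfolding exp_int_def by (rule set_integral_mult_right)
    finally show ?thesis .
  qed
  finally have "(\<lambda>n. real (n + Suc N) * measure (gamma_distribution (a (n + Suc N))) {x<..}) \<longlonglongrightarrow> \<alpha> * exp_int x"
    by (rule tendsto_ennrealD) (use \<alpha> x exp_int_nonneg in auto)
  thus ?thesis by (rule LIMSEQ_offset)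
qed

lemma tendsto_gamma_max_law_cdf:
  assumes x: "0 < x"
  shows "(\<lambda>n. measure (gamma_max_law n (a n)) {..x}) \<longlonglongrightarrow> F_cdf \<alpha> x"
proof -
  have "(\<lambda>n. (1 - measure (gamma_distribution (a n)) {x<..}) ^ n) \<longlonglongrightarrow> exp (- (\<alpha> * exp_int x))"
    by (intro tendsto_one_minus_power_exp tendsto_gamma_tail x) auto
  hence "(\<lambda>n. (1 - measure (gamma_distribution (a n)) {x<..}) ^ n) \<longlonglongrightarrow> F_cdf \<alpha> x"
    using x by (simp add: F_cdf_def)
  moreover have "\<forall>\<^sub>F n in sequentially. (1 - measure (gamma_distribution (a n)) {x<..}) ^ n = measure (gamma_max_law n (a n)) {..x}"
    using eventually_ge_at_top[of 1] by eventually_elim (simp add: prob_gamma_max_law_atMost a_pos)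
  ultimately show ?thesis by (rule Lim_transform_eventually)
qed

lemma AE_gamma_max_law_nonneg:
  assumes n: "1 \<le> n"
  shows "AE x in gamma_max_law n (a n). 0 \<le> x"
proof -
  interpret M: real_distribution "gamma_max_law n (a n)"
    by (rule real_distribution_gamma_max_law) (use n a_pos in auto)
  have "(\<integral>\<^sup>+u. ennreal (gamma_density (a n) u) * indicator {..0} u \<partial>lborel) = (\<integral>\<^sup>+u. 0 \<partial>(lborel :: real measure))"
    by (intro nn_integral_cong) (auto split: split_indicator)
  hence "emeasure (gamma_max_law n (a n)) {..0} = 0"
    using n by (simp add: emeasure_gamma_max_law_atMost)
  hence "{..0} \<in> null_sets (gamma_max_law n (a n))" by (auto intro!: null_setsI)
  thus ?thesis by (rule AE_I'[where N="{..0}"]) auto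
qed

text \<open>The tails of the maximum are dominated by the tails of the measure with density
  \<open>envelope\<close>. That the dominating function is integrable follows by reading the
  layer-cake formula backwards: its integral is the k-th moment of that measure.\<close>

lemma tendsto_gamma_max_law_power:
  assumes k: "1 \<le> k"
  shows "(\<lambda>n. \<integral>\<^sup>+u. ennreal (u ^ k) \<partial>gamma_max_law n (a n)) \<longlonglongrightarrow> (\<integral>\<^sup>+x. ennreal (x ^ k) \<partial>F_distribution \<alpha>)"
proof -
  obtain N where N: "\<And>n x. N \<le> n \<Longrightarrow> ennreal (real n * measure (gamma_distribution (a n)) {x<..}) \<le>
      (\<integral>\<^sup>+u. ennreal (envelope u) * indicator {x<..} u \<partial>lborel)"
    using emeasure_gamma_tail_le_envelope unfolding eventually_sequentially by blast
  let ?w = "\<lambda>t. ennreal (real k * t ^ (k - 1)) * indicator {0<..} t"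
  let ?p = "\<lambda>n t. measure (gamma_max_law n (a n)) {..t}"
  let ?D = "density lborel (\<lambda>u. ennreal (envelope u))"
  have D: "emeasure ?D {x \<in> space ?D. t < x} = (\<integral>\<^sup>+u. ennreal (envelope u) * indicator {t<..} u \<partial>lborel)" for t
    by (subst emeasure_density) (auto simp: greaterThan_def)
  have sf: "sigma_finite_measure ?D"
    by (subst sigma_finite_measure.sigma_finite_iff_density_finite[OF sigma_finite_lborel]) auto
  have law: "(\<integral>\<^sup>+u. ennreal (u ^ k) \<partial>gamma_max_law n (a n)) = (\<integral>\<^sup>+t. ?w t * ennreal (1 - ?p n t) \<partial>lborel)"
    if n: "1 \<le> n" for n
  proof -
    interpret M: real_distribution "gamma_max_law n (a n)"
      by (rule real_distribution_gamma_max_law) (use n a_pos in auto)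
    have tail: "emeasure (gamma_max_law n (a n)) {x \<in> space (gamma_max_law n (a n)). t < x} = ennreal (1 - ?p n t)" for t
    proof -
      have "{x \<in> space (gamma_max_law n (a n)). t < x} = space (gamma_max_law n (a n)) - {..t}" by auto
      thus ?thesis using M.prob_compl[of "{..t}"] by (simp add: M.emeasure_eq_measure)
    qed
    show ?thesis unfolding tail[symmetric]
      using AE_gamma_max_law_nonneg[OF n] k
      by (intro nn_integral_power_eq_tails M.sigma_finite_measure_axioms) auto
  qed
  have "(\<lambda>n. \<integral>\<^sup>+t. ?w t * ennreal (1 - ?p (n + Suc N) t) \<partial>lborel) \<longlonglongrightarrow> (\<integral>\<^sup>+t. ?w t * ennreal (1 - F_cdf \<alpha> t) \<partial>lborel)"
  proof (rule nn_integral_dominated_convergence[where w="\<lambda>t. ?w t * emeasure ?D {x \<in> space ?D. t < x}"])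
    show "(\<lambda>t. ?w t * ennreal (1 - ?p (n + Suc N) t)) \<in> borel_measurable lborel" for n
    proof -
      interpret M: real_distribution "gamma_max_law (n + Suc N) (a (n + Suc N))"
        by (rule real_distribution_gamma_max_law) (use a_pos in auto)
      have [measurable]: "?p (n + Suc N) \<in> borel_measurable borel"
        by (intro borel_measurable_mono monoI M.finite_measure_mono) auto
      show ?thesis by measurable
    qed
    have [measurable]: "F_cdf \<alpha> \<in> borel_measurable borel"
      unfolding F_cdf_def[abs_def] by measurable
    show "(\<lambda>t. ?w t * ennreal (1 - F_cdf \<alpha> t)) \<in> borel_measurable lborel"
      by measurable
    interpret D: sigma_finite_measure ?D by (rule sf)
    show "(\<lambda>t. ?w t * emeasure ?D {x \<in> space ?D. t < x}) \<in> borel_measurable lborel"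
      by measurable
    show "AE t in lborel. ?w t * ennreal (1 - ?p (n + Suc N) t) \<le> ?w t * emeasure ?D {x \<in> space ?D. t < x}" for n
    proof (intro AE_I2 mult_left_mono)
      fix t :: real
      let ?m = "n + Suc N"
      let ?r = "measure (gamma_distribution (a ?m)) {t<..}"
      interpret G: real_distribution "gamma_distribution (a ?m)"
        by (rule real_distribution_gamma_distribution) (use a_pos in auto)
      \<comment> \<open>Bernoulli's inequality plays the role of a union bound: the tail of the
        maximum is at most \<open>?m\<close> times a single tail.\<close>
      have "1 + real ?m * (- ?r) \<le> (1 + (- ?r)) ^ ?m"
        using G.prob_le_1[of "{t<..}"] by (intro Bernoulli_inequality) linarith
      hence "1 - ?p ?m t \<le> real ?m * ?r"
        using prob_gamma_max_law_atMost[OF a_pos[of ?m], of ?m t] by simp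
      hence "ennreal (1 - ?p ?m t) \<le> ennreal (real ?m * ?r)" by (rule ennreal_leI)
      also have "\<dots> \<le> emeasure ?D {x \<in> space ?D. t < x}"
        unfolding D by (rule N) simp
      finally show "ennreal (1 - ?p ?m t) \<le> emeasure ?D {x \<in> space ?D. t < x}" .
    qed simp
    have "(\<integral>\<^sup>+t. ?w t * emeasure ?D {x \<in> space ?D. t < x} \<partial>lborel) = (\<integral>\<^sup>+u. ennreal (u ^ k) \<partial>?D)"
      using k by (intro nn_integral_power_eq_tails[symmetric] sf) (auto simp: AE_density envelope_def)
    also have "\<dots> < \<infinity>"
      using nn_integral_envelope_power_finite[OF k] by (simp add: nn_integral_density)
    finally show "(\<integral>\<^sup>+t. ?w t * emeasure ?D {x \<in> space ?D. t < x} \<partial>lborel) < \<infinity>" .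
    show "AE t in lborel. (\<lambda>n. ?w t * ennreal (1 - ?p (n + Suc N) t)) \<longlonglongrightarrow> ?w t * ennreal (1 - F_cdf \<alpha> t)"
    proof (intro AE_I2)
      fix t :: real
      show "(\<lambda>n. ?w t * ennreal (1 - ?p (n + Suc N) t)) \<longlonglongrightarrow> ?w t * ennreal (1 - F_cdf \<alpha> t)"
      proof (cases "0 < t")
        case True
        have "(\<lambda>n. ennreal (real k * t ^ (k - 1)) * ennreal (1 - ?p (n + Suc N) t)) \<longlonglongrightarrow> ennreal (real k * t ^ (k - 1)) * ennreal (1 - F_cdf \<alpha> t)"
          by (intro ennreal_tendsto_cmult tendsto_ennrealI tendsto_intros
             LIMSEQ_ignore_initial_segment[OF tendsto_gamma_max_law_cdf[OF True]]) simp
        thus ?thesis using True by simp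
      qed simp
    qed
  qed
  hence "(\<lambda>n. \<integral>\<^sup>+u. ennreal (u ^ k) \<partial>gamma_max_law (n + Suc N) (a (n + Suc N))) \<longlonglongrightarrow> (\<integral>\<^sup>+x. ennreal (x ^ k) \<partial>F_distribution \<alpha>)"
    using law nn_integral_power_F_distribution_tails[OF \<alpha> k] by simp
  thus ?thesis by (rule LIMSEQ_offset)
qed

end


lemma has_bochner_integral_gamma_distribution_power:
  assumes d: "0 < d"
  shows "has_bochner_integral (gamma_distribution d) (\<lambda>x. x ^ k) (Gamma (d + real k) / Gamma d)"
proof (rule has_bochner_integral_nn_integral)
  show "AE x in gamma_distribution d. 0 \<le> x ^ k"
    unfolding gamma_distribution_def by (auto simp: AE_density gamma_density_def)
  show "(\<integral>\<^sup>+x. ennreal (x ^ k) \<partial>gamma_distribution d) = ennreal (Gamma (d + real k) / Gamma d)"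
    using d by (simp add: nn_integral_gamma_distribution nn_integral_gamma_density_power)
  show "0 \<le> Gamma (d + real k) / Gamma d"
    using d by (intro divide_nonneg_pos Gamma_real_pos less_imp_le[OF Gamma_real_pos]) auto
qed simp

section \<open>The law of the maximum of a Dirichlet vector\<close>

text \<open>Markov's inequality: the mean is \<open>d\<close>, so the mass beyond \<open>K\<close>
  is at most d / K.\<close>

lemma gamma_distribution_atMost_ge_half:
  assumes d: "0 < d" and K: "2 * d \<le> K"
  shows "1 / 2 \<le> measure (gamma_distribution d) {..K}"
proof -
  interpret G: real_distribution "gamma_distribution d" by (rule real_distribution_gamma_distribution) fact
  have K0: "0 < K" using d K by simp
  have "emeasure (gamma_distribution d) {K<..} \<le> (\<integral>\<^sup>+u. ennreal (gamma_density d u) * ennreal (u ^ 1) * ennreal (1 / K) \<partial>lborel)"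
    unfolding emeasure_gamma_distribution[of "{K<..}", simplified]
  proof (rule nn_integral_mono)
    fix u :: real
    show "ennreal (gamma_density d u) * indicator {K<..} u \<le> ennreal (gamma_density d u) * ennreal (u ^ 1) * ennreal (1 / K)"
    proof (cases "K < u")
      case True
      hence "ennreal 1 \<le> ennreal (u * (1 / K))" using K0 by (intro ennreal_leI) simp
      also have "\<dots> = ennreal (u ^ 1) * ennreal (1 / K)" using True K0 by (subst ennreal_mult[symmetric]) auto
      finally have "ennreal (gamma_density d u) * ennreal 1 \<le> ennreal (gamma_density d u) * (ennreal (u ^ 1) * ennreal (1 / K))"
        by (rule mult_left_mono) simp
      thus ?thesis using True by (simp add: mult.assoc)
    qed simp
  qed
  also have "\<dots> = ennreal (Gamma (d + real 1) / Gamma d) * ennreal (1 / K)"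
    unfolding nn_integral_gamma_density_power[OF d, symmetric] by (rule nn_integral_multc) measurable
  also have "Gamma (d + real 1) / Gamma d = d"
  proof -
    have "Gamma d \<noteq> 0" using Gamma_real_pos[OF d] by linarith
    thus ?thesis using d by (subst of_nat_1, subst Gamma_plus1) (auto elim!: nonpos_Ints_cases)
  qed
  also have "ennreal d * ennreal (1 / K) = ennreal (d / K)"
    using d K0 by (subst ennreal_mult[symmetric]) auto
  finally have "G.prob {K<..} \<le> d / K"
    using d K0 by (simp add: G.emeasure_eq_measure)
  also have "\<dots> \<le> 1 / 2" using d K by (simp add: field_simps)
  finally have "G.prob {K<..} \<le> 1 / 2" .
  moreover have "space (gamma_distribution d) - {K<..} = {..K}" by auto
  ultimately show ?thesis using G.prob_compl[of "{K<..}"] by simp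
qed

lemma (in real_distribution) integrable_power_unit_interval:
  assumes "AE x in M. x \<in> {0..1}"
  shows "integrable M (\<lambda>x. x ^ k)"
proof (rule integrable_const_bound[where B=1])
  show "AE x in M. norm (x ^ k) \<le> 1"
    using assms by eventually_elim (simp add: power_abs power_le_one)
qed simp

context
  fixes P :: "'a measure" and X :: "nat \<Rightarrow> 'a \<Rightarrow> real" and n :: nat and a b :: real
  assumes n: "1 \<le> n" and a: "0 < a" and b: "0 < b" and P: "prob_space P"
    and D: "distributed P (PiM {1..n} (\<lambda>_. lborel)) (\<lambda>\<omega>. \<lambda>i\<in>{1..n}. X i \<omega>)
             (\<lambda>x. ennreal (dirichlet_density n a b x))"
begin

abbreviation (input) max_law :: "real measure" where
  "max_law \<equiv> distr P borel (\<lambda>\<omega>. Max ((\<lambda>i. X i \<omega>) ` {1..n}))"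

lemma measurable_Max_X [measurable]: "(\<lambda>\<omega>. Max ((\<lambda>i. X i \<omega>) ` {1..n})) \<in> borel_measurable P"
proof -
  have "(\<lambda>\<omega>. Max ((\<lambda>i\<in>{1..n}. X i \<omega>) ` {1..n})) \<in> borel_measurable P"
    by (rule measurable_compose[OF distributed_measurable[OF D] measurable_Max_PiM]) simp
  thus ?thesis by simp
qed

lemma real_distribution_max_law: "real_distribution max_law"
  unfolding real_distribution_def real_distribution_axioms_def
  using prob_space.prob_space_distr[OF P measurable_Max_X] by simp

lemma nn_integral_max_law:
  assumes [measurable]: "h \<in> borel_measurable borel"
  shows "(\<integral>\<^sup>+m. h m \<partial>max_law) =
    (\<integral>\<^sup>+x. ennreal (dirichlet_density n a b x) * h (Max (x ` {1..n})) \<partial>PiM {1..n} (\<lambda>_. lborel))"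
proof -
  have "(\<integral>\<^sup>+m. h m \<partial>max_law) = (\<integral>\<^sup>+\<omega>. h (Max ((\<lambda>i\<in>{1..n}. X i \<omega>) ` {1..n})) \<partial>P)"
    by (subst nn_integral_distr[OF measurable_Max_X]) (use assms in simp_all)
  also have "\<dots> = (\<integral>\<^sup>+x. ennreal (dirichlet_density n a b x) * h (Max (x ` {1..n})) \<partial>PiM {1..n} (\<lambda>_. lborel))"
    by (rule distributed_nn_integral[OF D, symmetric]) measurable
  finally show ?thesis .
qed

lemma nn_integral_max_law_times_gamma:
  assumes [measurable]: "h \<in> borel_measurable borel"
  shows "(\<integral>\<^sup>+m. (\<integral>\<^sup>+s. ennreal (gamma_density (real n * a + b) s) * h (s * m) \<partial>lborel) \<partial>max_law) =
         (\<integral>\<^sup>+u. h u \<partial>gamma_max_law n a)"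
  by (subst nn_integral_max_law, measurable) (rule dirichlet_max_times_gamma[OF a b n assms])

lemma AE_max_law_unit: "AE m in max_law. m \<in> {0..1}"
proof -
  have "emeasure max_law (- {0..1}) = (\<integral>\<^sup>+m. indicator (- {0..1}) m \<partial>max_law)"
    by (subst nn_integral_indicator) auto
  also have "\<dots> = (\<integral>\<^sup>+x. ennreal (dirichlet_density n a b x) * indicator (- {0..1}) (Max (x ` {1..n})) \<partial>PiM {1..n} (\<lambda>_. lborel))"
    by (rule nn_integral_max_law) simp
  also have "\<dots> = (\<integral>\<^sup>+x. 0 \<partial>PiM {1..n} (\<lambda>_. lborel :: real measure))"
  proof (rule nn_integral_cong)
    fix x :: "nat \<Rightarrow> real"
    have "Max (x ` {1..n}) \<in> {0..1}" if "\<forall>i\<in>{1..n}. 0 \<le> x i" "(\<Sum>i=1..n. x i) \<le> 1"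
    proof -
      have "Max (x ` {1..n}) \<in> x ` {1..n}" using n by (intro Max_in) auto
      then obtain j where j: "j \<in> {1..n}" "Max (x ` {1..n}) = x j" by auto
      have "x j \<le> (\<Sum>i=1..n. x i)" using j(1) that(1) by (intro member_le_sum) auto
      thus ?thesis using j that by auto
    qed
    thus "ennreal (dirichlet_density n a b x) * indicator (- {0..1}) (Max (x ` {1..n})) = 0"
      unfolding dirichlet_density_def by (auto simp: indicator_def)
  qed
  finally have "- {0..1} \<in> null_sets max_law" by (auto intro!: null_setsI)
  thus ?thesis by (rule AE_I'[where N="- {0..1}"]) auto
qed

text \<open>With the test function u^k the product identity separates, since (s * m)^k = s^k * m^k
  and the Gamma moment is explicit. The equation lives in \<open>ennreal\<close>, so finiteness of
  the right side need not be known beforehand.\<close>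

lemma max_law_power:
  shows "ennreal ((LINT m|max_law. m ^ k) * (Gamma (real n * a + b + real k) / Gamma (real n * a + b))) =
     (\<integral>\<^sup>+u. ennreal (u ^ k) \<partial>gamma_max_law n a)"
proof -
  interpret M: real_distribution max_law by (rule real_distribution_max_law)
  let ?c = "real n * a + b"
  have c: "0 < ?c" using a b by (simp add: add_nonneg_pos)
  let ?q = "Gamma (?c + real k) / Gamma ?c"
  have q: "0 \<le> ?q" using c by (intro divide_nonneg_pos Gamma_real_pos less_imp_le[OF Gamma_real_pos]) auto
  have "integrable max_law (\<lambda>m. m ^ k)"
    by (rule M.integrable_power_unit_interval[OF AE_max_law_unit])
  hence "ennreal (LINT m|max_law. m ^ k) = (\<integral>\<^sup>+m. ennreal (m ^ k) \<partial>max_law)"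
    using AE_max_law_unit by (intro nn_integral_eq_integral[symmetric]) (auto elim!: eventually_mono)
  hence "ennreal ((LINT m|max_law. m ^ k) * ?q) = (\<integral>\<^sup>+m. ennreal (m ^ k) \<partial>max_law) * ennreal ?q"
    by (subst ennreal_mult''[OF q]) (rule arg_cong[where f="\<lambda>z. z * ennreal ?q"])
  also have "\<dots> = (\<integral>\<^sup>+m. ennreal (m ^ k) * ennreal ?q \<partial>max_law)"
    by (rule nn_integral_multc[symmetric]) simp
  also have "\<dots> = (\<integral>\<^sup>+m. (\<integral>\<^sup>+s. ennreal (gamma_density ?c s) * ennreal ((s * m) ^ k) \<partial>lborel) \<partial>max_law)"
  proof (rule nn_integral_cong_AE, use AE_max_law_unit in eventually_elim)
    fix m :: real assume m: "m \<in> {0..1}"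
    have "ennreal (m ^ k) * ennreal ?q = (\<integral>\<^sup>+s. ennreal (m ^ k) * (ennreal (gamma_density ?c s) * ennreal (s ^ k)) \<partial>lborel)"
      by (simp add: nn_integral_cmult nn_integral_gamma_density_power c)
    also have "\<dots> = (\<integral>\<^sup>+s. ennreal (gamma_density ?c s) * ennreal ((s * m) ^ k) \<partial>lborel)"
    proof (rule nn_integral_cong)
      fix s :: real
      show "ennreal (m ^ k) * (ennreal (gamma_density ?c s) * ennreal (s ^ k)) = ennreal (gamma_density ?c s) * ennreal ((s * m) ^ k)"
        \<comment> \<open>For s <= 0 the Gamma density is 0, so the truncation of negative powers by
          \<open>ennreal\<close> does no harm.\<close>
        using m by (cases "0 < s") (auto simp: power_mult_distrib ennreal_mult mult_ac)
    qed
    finally show "ennreal (m ^ k) * ennreal ?q = (\<integral>\<^sup>+s. ennreal (gamma_density ?c s) * ennreal ((s * m) ^ k) \<partial>lborel)" .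
  qed
  also have "\<dots> = (\<integral>\<^sup>+u. ennreal (u ^ k) \<partial>gamma_max_law n a)"
    by (rule nn_integral_max_law_times_gamma) measurable
  finally show ?thesis .
qed

text \<open>If the Dirichlet maximum \<open>M\<close> is at most \<open>e\<close> and the independent Gamma variable \<open>S\<close> is at most
  \<open>K\<close>, then \<open>S * M \<le> e * K\<close>; Markov's inequality gives \<open>S \<le> K\<close> probability at least \<open>1 / 2\<close>.
  This is what excludes an atom of the limit law at \<open>0\<close>.\<close>
lemma max_law_atMost_le:
  assumes K: "2 * (real n * a + b) \<le> K" and e: "0 < e"
  shows "measure max_law {..e} \<le> 2 * measure (gamma_max_law n a) {..e * K}"
proof -
  interpret M: real_distribution max_law by (rule real_distribution_max_law)
  interpret N: real_distribution "gamma_max_law n a" by (rule real_distribution_gamma_max_law) fact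
  let ?c = "real n * a + b"
  have c: "0 < ?c" using a b by (simp add: add_nonneg_pos)
  interpret G: real_distribution "gamma_distribution ?c" by (rule real_distribution_gamma_distribution) fact
  have "emeasure max_law {..e} * emeasure (gamma_distribution ?c) {..K} =
      (\<integral>\<^sup>+m. indicator {..e} m * emeasure (gamma_distribution ?c) {..K} \<partial>max_law)"
    by (simp add: nn_integral_multc)
  also have "\<dots> \<le> (\<integral>\<^sup>+m. (\<integral>\<^sup>+s. ennreal (gamma_density ?c s) * indicator {..e * K} (s * m) \<partial>lborel) \<partial>max_law)"
  proof (rule nn_integral_mono)
    fix m :: real
    have "s * m \<le> e * K" if "0 < s" "s \<le> K" "m \<le> e" for s
    proof -
      have "s * m \<le> s * e" using that by (intro mult_left_mono) auto
      also have "\<dots> \<le> K * e" using that e by (intro mult_right_mono) auto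
      finally show ?thesis by (simp add: mult.commute)
    qed
    hence "ennreal (gamma_density ?c s) * indicator {..K} s \<le> ennreal (gamma_density ?c s) * indicator {..e * K} (s * m)"
      if "m \<le> e" for s
      using that by (cases "0 < s") (auto split: split_indicator)
    thus "indicator {..e} m * emeasure (gamma_distribution ?c) {..K} \<le>
      (\<integral>\<^sup>+s. ennreal (gamma_density ?c s) * indicator {..e * K} (s * m) \<partial>lborel)"
      by (auto simp: emeasure_gamma_distribution intro!: nn_integral_mono split: split_indicator)
  qed
  also have "\<dots> = emeasure (gamma_max_law n a) {..e * K}"
    by (subst nn_integral_max_law_times_gamma) auto
  finally have "M.prob {..e} * G.prob {..K} \<le> N.prob {..e * K}"
    unfolding M.emeasure_eq_measure N.emeasure_eq_measure G.emeasure_eq_measure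
    by (subst (asm) ennreal_mult[symmetric]) (auto simp del: One_nat_def)
  moreover have "M.prob {..e} * (1 / 2) \<le> M.prob {..e} * G.prob {..K}"
    by (intro mult_left_mono gamma_distribution_atMost_ge_half c K) auto
  ultimately show ?thesis by simp
qed

end

section \<open>The method of moments on the unit interval\<close>

text \<open>The moments are the Taylor coefficients of the characteristic function. All absolute
  moments are at most 1, so the Taylor remainder is at most 2 * |t|^n / n! and the series converges
  to the characteristic function at every t.\<close>

lemma moments_unit_interval_unique:
  assumes "real_distribution M" "real_distribution N"
    and M: "AE x in M. x \<in> {0..1}" and N: "AE x in N. x \<in> {0..1}"
    and eq: "\<And>k. 1 \<le> k \<Longrightarrow> (LINT x|M. x ^ k) = (LINT x|N. x ^ k)"
  shows "M = N"
proof (rule Levy_uniqueness)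
  have lim: "(\<lambda>n. \<Sum>k\<le>n. ((\<i> * t) ^ k / fact k) * (LINT x|L. x ^ k)) \<longlonglongrightarrow> char L t"
    if "real_distribution L" and L: "AE x in L. x \<in> {0..1}" for L t
  proof -
    interpret L: real_distribution L by fact
    have int: "integrable L (\<lambda>x. x ^ k)" for k
      by (rule L.integrable_power_unit_interval[OF L])
    have int_abs: "integrable L (\<lambda>x. \<bar>x\<bar> ^ k)" for k
      using integrable_norm[OF int] by (simp add: power_abs)
    have "(\<lambda>n. char L t - (\<Sum>k\<le>n. ((\<i> * t) ^ k / fact k) * (LINT x|L. x ^ k))) \<longlonglongrightarrow> 0"
    proof (rule Lim_null_comparison)
      show "\<forall>\<^sub>F n in sequentially. norm (char L t - (\<Sum>k\<le>n. ((\<i> * t) ^ k / fact k) * (LINT x|L. x ^ k))) \<le> 2 * (\<bar>t\<bar> ^ n / fact n)"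
      proof (rule always_eventually, rule allI)
        fix n
        have "(LINT x|L. \<bar>x\<bar> ^ n) \<le> (LINT x|L. 1)"
        proof (rule integral_mono_AE[OF int_abs])
          show "AE x in L. \<bar>x\<bar> ^ n \<le> 1" using L by eventually_elim (simp add: power_le_one)
        qed simp
        hence "(2 * \<bar>t\<bar> ^ n / fact n) * (LINT x|L. \<bar>x\<bar> ^ n) \<le> (2 * \<bar>t\<bar> ^ n / fact n) * 1"
          using L.prob_space by (intro mult_left_mono) auto
        thus "norm (char L t - (\<Sum>k\<le>n. ((\<i> * t) ^ k / fact k) * (LINT x|L. x ^ k))) \<le> 2 * (\<bar>t\<bar> ^ n / fact n)"
          using L.char_approx1[OF int, where n=n and t=t] by simp
      qed
      have "(\<lambda>n. \<bar>t\<bar> ^ n / fact n) \<longlonglongrightarrow> 0"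
        using summable_LIMSEQ_zero[OF summable_exp[of "\<bar>t\<bar>"]] by (simp add: field_simps)
      from tendsto_mult_right_zero[OF this, of 2] show "(\<lambda>n. 2 * (\<bar>t\<bar> ^ n / fact n)) \<longlonglongrightarrow> 0" .
    qed
    from tendsto_diff[OF tendsto_const[of "char L t"] this] show ?thesis by simp
  qed
  show "char M = char N"
  proof
    fix t
    interpret M: real_distribution M by fact
    interpret N: real_distribution N by fact
    \<comment> \<open>The moment of order 0 is not covered by \<open>eq\<close>; it is the total
      mass 1.\<close>
    have "(LINT x|M. x ^ k) = (LINT x|N. x ^ k)" for k
      using eq[of k] M.prob_space N.prob_space by (cases "k = 0") auto
    hence "(\<lambda>n. \<Sum>k\<le>n. ((\<i> * t) ^ k / fact k) * (LINT x|M. x ^ k)) \<longlonglongrightarrow> char N t"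
      using lim[OF assms(2) N, of t] by simp
    with lim[OF assms(1) M, of t] show "char M t = char N t" by (rule LIMSEQ_unique)
  qed
qed fact+

text \<open>Tightness supplies a subsequential limit. Every such limit lives on the unit interval
  and has the moments \<open>m\<close>, so all of them coincide, and the whole sequence
  converges.\<close>

theorem method_of_moments_unit_interval:
  fixes \<nu> :: "nat \<Rightarrow> real measure" and m :: "nat \<Rightarrow> real"
  assumes \<nu>: "\<And>n. real_distribution (\<nu> n)" and unit: "\<And>n. AE x in \<nu> n. x \<in> {0..1}"
    and lim: "\<And>k. 1 \<le> k \<Longrightarrow> (\<lambda>n. LINT x|\<nu> n. x ^ k) \<longlonglongrightarrow> m k"
  obtains H where "real_distribution H" "AE x in H. x \<in> {0..1}"
    "\<And>k. 1 \<le> k \<Longrightarrow> (LINT x|H. x ^ k) = m k" "weak_conv_m \<nu> H"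
proof -
  \<comment> \<open>Powers are unbounded on the real line and cannot serve as test functions for
    weak convergence. The clamp \<open>c\<close> onto the unit interval makes them bounded and
    continuous without changing them on the support.\<close>
  define c :: "real \<Rightarrow> real" where "c x = max 0 (min 1 x)" for x
  have cont_c: "isCont c x" for x unfolding c_def[abs_def] by (intro continuous_intros)
  have c01: "0 \<le> c x" "c x \<le> 1" for x by (auto simp: c_def)
  have c_id: "x \<in> {0..1} \<Longrightarrow> c x = x" for x by (simp add: c_def)
  have limit: "(AE x in M. x \<in> {0..1}) \<and> (\<forall>k\<ge>1. (LINT x|M. x ^ k) = m k)"
    if s: "strict_mono s" and M: "real_distribution M" and conv: "weak_conv_m (\<nu> \<circ> s) M" for s M
  proof -
    interpret M: real_distribution M by fact
    have \<nu>s: "\<And>n. real_distribution ((\<nu> \<circ> s) n)" by (simp add: \<nu>)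
    have [measurable]: "c \<in> borel_measurable borel" unfolding c_def[abs_def] by measurable
    \<comment> \<open>\<open>?g\<close> is continuous and bounded, and vanishes exactly on the unit
      interval; a zero integral in the limit therefore transfers the support to
      \<open>M\<close>.\<close>
    let ?g = "\<lambda>x. min 1 \<bar>x - c x\<bar>"
    have "(\<lambda>n. LINT x|(\<nu> \<circ> s) n. ?g x) \<longlonglongrightarrow> (LINT x|M. ?g x)"
      by (rule weak_conv_imp_integral_bdd_continuous_conv[OF \<nu>s M conv, where B=1])
         (auto intro!: continuous_intros cont_c)
    moreover have "(LINT x|(\<nu> \<circ> s) n. ?g x) = 0" for n
    proof -
      have "AE x in \<nu> (s n). ?g x = 0" using unit[of "s n"] by eventually_elim (simp add: c_id)
      thus ?thesis by (simp add: integral_eq_zero_AE)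
    qed
    ultimately have "(LINT x|M. ?g x) = 0" by (simp add: LIMSEQ_const_iff)
    moreover have "integrable M ?g" by (intro M.integrable_const_bound[where B=1]) auto
    ultimately have "AE x in M. ?g x = 0" by (subst (asm) integral_nonneg_eq_0_iff_AE) auto
    hence unitM: "AE x in M. x \<in> {0..1}"
    proof eventually_elim
      case (elim x)
      hence "x = c x" by (simp add: min_def split: if_splits)
      thus ?case by (metis c01 atLeastAtMost_iff)
    qed
    have "(LINT x|M. x ^ k) = m k" if k: "1 \<le> k" for k
    proof -
      have "(\<lambda>n. LINT x|(\<nu> \<circ> s) n. c x ^ k) \<longlonglongrightarrow> (LINT x|M. c x ^ k)"
        by (rule weak_conv_imp_integral_bdd_continuous_conv[OF \<nu>s M conv, where B=1])
           (use c01 in \<open>auto intro!: continuous_intros cont_c simp: power_abs power_le_one\<close>)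
      moreover have "(LINT x|(\<nu> \<circ> s) n. c x ^ k) = (LINT x|\<nu> (s n). x ^ k)" for n
      proof -
        interpret N: real_distribution "\<nu> (s n)" by (rule \<nu>)
        have "AE x in \<nu> (s n). c x ^ k = x ^ k" using unit[of "s n"] by eventually_elim (simp add: c_id)
        thus ?thesis by (simp, intro integral_cong_AE) auto
      qed
      moreover have "AE x in M. c x ^ k = x ^ k" using unitM by eventually_elim (simp add: c_id)
      hence "(LINT x|M. c x ^ k) = (LINT x|M. x ^ k)" by (intro integral_cong_AE) auto
      ultimately have "(\<lambda>n. LINT x|\<nu> (s n). x ^ k) \<longlonglongrightarrow> (LINT x|M. x ^ k)" by simp
      moreover have "(\<lambda>n. LINT x|\<nu> (s n). x ^ k) \<longlonglongrightarrow> m k"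
        using LIMSEQ_subseq_LIMSEQ[OF lim[OF k] s] by (simp add: comp_def)
      ultimately show ?thesis by (rule LIMSEQ_unique)
    qed
    thus ?thesis using unitM by simp
  qed
  have tight: "tight \<nu>"
    unfolding tight_def
  proof (intro conjI allI impI \<nu>)
    fix \<epsilon> :: real assume "0 < \<epsilon>"
    \<comment> \<open>Tightness is phrased with intervals open on the left, so the left end lies
      strictly below 0 in order to include that point.\<close>
    have "measure (\<nu> n) {-1<..1} = 1" for n
    proof -
      interpret N: real_distribution "\<nu> n" by (rule \<nu>)
      have "AE x in \<nu> n. x \<in> {-1<..1}" using unit[of n] by eventually_elim auto
      thus ?thesis by (subst N.prob_eq_1) auto
    qed
    thus "\<exists>a b::real. a < b \<and> (\<forall>n. 1 - \<epsilon> < measure (\<nu> n) {a<..b})"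
      using \<open>0 < \<epsilon>\<close> by (intro exI[of _ "-1"] exI[of _ 1]) simp
  qed
  obtain r H where r: "strict_mono (r :: nat \<Rightarrow> nat)" and H: "real_distribution H" and conv: "weak_conv_m (\<nu> \<circ> id \<circ> r) H"
    using tight_imp_convergent_subsubsequence[OF tight strict_mono_id] by blast
  have limH: "(AE x in H. x \<in> {0..1}) \<and> (\<forall>k\<ge>1. (LINT x|H. x ^ k) = m k)"
    by (rule limit[OF r H]) (use conv in simp)
  have "weak_conv_m \<nu> H"
  proof (rule tight_subseq_weak_converge[OF \<nu> H tight])
    fix s \<mu> assume s: "strict_mono s" and \<mu>: "real_distribution \<mu>" and conv: "weak_conv_m (\<nu> \<circ> s) \<mu>"
    have "\<mu> = H"
      using limit[OF s \<mu> conv] limH by (intro moments_unit_interval_unique \<mu> H) auto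
    thus "weak_conv_m (\<nu> \<circ> s) H" using conv by simp
  qed
  thus ?thesis using that H limH by blast
qed

section \<open>Convergence of the Dirichlet maxima\<close>

text \<open>Integrability accompanies the moments because the integral of a nonintegrable function
  is 0 by default, which would empty the quotient of its meaning.\<close>

theorem theorem3p1:
  fixes \<alpha> \<beta> :: real
    and a b :: "nat \<Rightarrow> real"
    and P :: "nat \<Rightarrow> 'a measure"
    and X :: "nat \<Rightarrow> nat \<Rightarrow> 'a \<Rightarrow> real"
  assumes "\<And>n. 1 \<le> n \<Longrightarrow> 0 < a n"
    and "\<And>n. 1 \<le> n \<Longrightarrow> 0 < b n"
    and "\<And>n. 1 \<le> n \<Longrightarrow> prob_space (P n)"
    and "\<And>n. 1 \<le> n \<Longrightarrow>
           distributed (P n) (PiM {1..n} (\<lambda>_. lborel)) (\<lambda>\<omega>. \<lambda>i\<in>{1..n}. X n i \<omega>)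
             (\<lambda>x. ennreal (dirichlet_density n (a n) (b n) x))"
    and "(\<lambda>n. real n * a n) \<longlonglongrightarrow> \<alpha>" and "0 < \<alpha>"
    and "b \<longlonglongrightarrow> \<beta>" and "0 \<le> \<beta>"
  shows "\<exists>H :: real measure.
      real_distribution H \<and> measure H {0<..} = 1
    \<and> (\<forall>k::nat. 1 \<le> k \<longrightarrow>
          integrable (gamma_distribution (\<alpha> + \<beta>)) (\<lambda>x. x ^ k)
        \<and> has_bochner_integral (F_distribution \<alpha>) (\<lambda>x. x ^ k)
            (\<alpha> * (LBINT x:{0<..}. x ^ (k - 1) * exp (- x - \<alpha> * (LBINT u:{x<..}. exp (- u) / u))))
        \<and> set_integrable lborel {0<..}
            (\<lambda>x. x ^ (k - 1) * exp (- x - \<alpha> * (LBINT u:{x<..}. exp (- u) / u)))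
        \<and> has_bochner_integral H (\<lambda>x. x ^ k)
            ((LINT x|F_distribution \<alpha>. x ^ k) / (LINT x|gamma_distribution (\<alpha> + \<beta>). x ^ k)))
    \<and> weak_conv_m (\<lambda>n. distr (P n) borel (\<lambda>\<omega>. Max ((\<lambda>i. X n i \<omega>) ` {1..n}))) H"
proof -
  note \<alpha> = \<open>0 < \<alpha>\<close>
  define \<nu> where "\<nu> n = distr (P n) borel (\<lambda>\<omega>. Max ((\<lambda>i. X n i \<omega>) ` {1..n}))" for n
  define c where "c n = real n * a n + b n" for n
  note max_facts = assms(1-4)
  have \<gamma>: "0 < \<alpha> + \<beta>" using assms by simp
  have c_lim: "c \<longlonglongrightarrow> \<alpha> + \<beta>" unfolding c_def by (intro tendsto_intros assms)
  have \<nu>: "real_distribution (\<nu> n)" and unit: "AE x in \<nu> n. x \<in> {0..1}" if "1 \<le> n" for n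
    unfolding \<nu>_def
    using real_distribution_max_law[OF that max_facts[OF that]] AE_max_law_unit[OF that max_facts[OF that]] by auto
  define m where "m k = (LINT x|F_distribution \<alpha>. x ^ k) / (LINT x|gamma_distribution (\<alpha> + \<beta>). x ^ k)" for k
  have F_moment: "has_bochner_integral (F_distribution \<alpha>) (\<lambda>x. x ^ k)
       (\<alpha> * (LBINT x:{0<..}. x ^ (k - 1) * exp (- x - \<alpha> * exp_int x)))" if "1 \<le> k" for k
    by (rule has_bochner_integral_power_F_distribution[OF \<alpha> that])
  have gamma_moment: "(LINT x|gamma_distribution (\<alpha> + \<beta>). x ^ k) = Gamma (\<alpha> + \<beta> + real k) / Gamma (\<alpha> + \<beta>)" for k
    using has_bochner_integral_gamma_distribution_power[OF \<gamma>] by (rule has_bochner_integral_integral_eq)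
  have moments: "(\<lambda>n. LINT x|\<nu> n. x ^ k) \<longlonglongrightarrow> m k" if k: "1 \<le> k" for k
  proof -
    let ?q = "\<lambda>n. Gamma (c n + real k) / Gamma (c n)"
    have qpos: "0 < Gamma (\<alpha> + \<beta> + real k) / Gamma (\<alpha> + \<beta>)"
      using \<gamma> by (intro divide_pos_pos Gamma_real_pos) auto
    have q_lim: "?q \<longlonglongrightarrow> Gamma (\<alpha> + \<beta> + real k) / Gamma (\<alpha> + \<beta>)"
    proof -
      have "Gamma (\<alpha> + \<beta>) \<noteq> 0" using Gamma_real_pos[OF \<gamma>] by linarith
      thus ?thesis using \<gamma>
        by (intro tendsto_divide tendsto_Gamma tendsto_intros c_lim) (auto elim!: nonpos_Ints_cases)
    qed
    have F_nonneg: "AE x in F_distribution \<alpha>. 0 \<le> x ^ k"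
      using AE_F_distribution_pos[OF \<alpha>] by eventually_elim simp
    have "(\<lambda>n. \<integral>\<^sup>+u. ennreal (u ^ k) \<partial>gamma_max_law n (a n)) \<longlonglongrightarrow> (\<integral>\<^sup>+x. ennreal (x ^ k) \<partial>F_distribution \<alpha>)"
      by (intro tendsto_gamma_max_law_power assms k)
    also have "(\<integral>\<^sup>+x. ennreal (x ^ k) \<partial>F_distribution \<alpha>) = ennreal (LINT x|F_distribution \<alpha>. x ^ k)"
      using F_moment[OF k] F_nonneg by (intro nn_integral_eq_integral) (auto simp: has_bochner_integral_iff)
    finally have "(\<lambda>n. \<integral>\<^sup>+u. ennreal (u ^ k) \<partial>gamma_max_law n (a n)) \<longlonglongrightarrow> ennreal (LINT x|F_distribution \<alpha>. x ^ k)" .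
    moreover have "\<forall>\<^sub>F n in sequentially. (\<integral>\<^sup>+u. ennreal (u ^ k) \<partial>gamma_max_law n (a n)) = ennreal ((LINT x|\<nu> n. x ^ k) * ?q n)"
      using eventually_ge_at_top[of 1]
    proof eventually_elim
      case (elim n)
      show ?case unfolding \<nu>_def c_def by (rule max_law_power[OF elim max_facts[OF elim], symmetric])
    qed
    ultimately have "(\<lambda>n. ennreal ((LINT x|\<nu> n. x ^ k) * ?q n)) \<longlonglongrightarrow> ennreal (LINT x|F_distribution \<alpha>. x ^ k)"
      by (rule Lim_transform_eventually)
    moreover have c_pos: "0 < c n" if "1 \<le> n" for n
      unfolding c_def using max_facts(1,2)[OF that] by (simp add: add_nonneg_pos)
    have "\<forall>\<^sub>F n in sequentially. 0 \<le> (LINT x|\<nu> n. x ^ k) * ?q n"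
      using eventually_ge_at_top[of 1]
    proof eventually_elim
      case (elim n)
      have "AE x in \<nu> n. 0 \<le> x ^ k" using unit[OF elim] by eventually_elim simp
      thus ?case using c_pos[OF elim]
        by (intro mult_nonneg_nonneg integral_nonneg_AE divide_nonneg_pos Gamma_real_pos less_imp_le[OF Gamma_real_pos]) auto
    qed
    moreover have "0 \<le> (LINT x|F_distribution \<alpha>. x ^ k)" using F_nonneg by (rule integral_nonneg_AE)
    ultimately have "(\<lambda>n. (LINT x|\<nu> n. x ^ k) * ?q n) \<longlonglongrightarrow> (LINT x|F_distribution \<alpha>. x ^ k)"
      by (intro tendsto_ennrealD)
    \<comment> \<open>Dividing by the Gamma moment is legitimate in the limit because
      \<open>?q\<close> tends to a positive number, hence is eventually nonzero.\<close>
    hence "(\<lambda>n. (LINT x|\<nu> n. x ^ k) * ?q n / ?q n) \<longlonglongrightarrow> m k"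
      unfolding m_def gamma_moment using qpos by (intro tendsto_divide q_lim) auto
    moreover have "\<forall>\<^sub>F n in sequentially. (LINT x|\<nu> n. x ^ k) * ?q n / ?q n = (LINT x|\<nu> n. x ^ k)"
      using order_tendstoD(1)[OF q_lim qpos] by eventually_elim auto
    ultimately show ?thesis by (rule Lim_transform_eventually)
  qed
  \<comment> \<open>The shift to \<open>Suc n\<close> avoids the index 0, about which nothing is
    assumed; the limit does not notice it.\<close>
  obtain H where H: "real_distribution H" and unitH: "AE x in H. x \<in> {0..1}"
    and mH: "\<And>k. 1 \<le> k \<Longrightarrow> (LINT x|H. x ^ k) = m k" and conv: "weak_conv_m (\<lambda>n. \<nu> (Suc n)) H"
  proof (rule method_of_moments_unit_interval[of "\<lambda>n. \<nu> (Suc n)" m])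
    show "(\<lambda>n. LINT x|\<nu> (Suc n). x ^ k) \<longlonglongrightarrow> m k" if "1 \<le> k" for k
      using LIMSEQ_Suc[OF moments[OF that]] .
  qed (use \<nu> unit in auto)
  interpret H: real_distribution H by fact
  have convH: "(\<lambda>n. cdf (\<nu> n) x) \<longlonglongrightarrow> cdf H x" if "isCont (cdf H) x" for x
    using conv that unfolding weak_conv_m_def weak_conv_def by (blast intro: LIMSEQ_imp_Suc)
  \<comment> \<open>\<open>c n\<close> is eventually below \<alpha> + \<beta> + 1, so this single
    \<open>K\<close> meets the requirement of \<open>max_law_atMost_le\<close> for all large
    n.\<close>
  define K where "K = 2 * (\<alpha> + \<beta> + 1)"
  have K: "0 < K" using \<gamma> by (simp add: K_def)
  have atom: "H.prob {..0} \<le> 2 * F_cdf \<alpha> (\<delta> * K)" if \<delta>: "0 < \<delta>" for \<delta>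
  proof -
    \<comment> \<open>Weak convergence gives the limit only at continuity points. \<open>H\<close>
      has countably many atoms, so one such point \<open>e\<close> lies below \<delta>, and
      monotonicity of \<open>F_cdf\<close> passes the bound from \<open>e\<close> to
      \<delta>.\<close>
    have "uncountable {0<..<\<delta>}" using \<delta> by (simp add: uncountable_open_interval)
    then obtain e where e: "e \<in> {0<..<\<delta>}" "\<not> 0 < H.prob {e}"
      using H.countable_atoms countable_subset[of "{0<..<\<delta>}" "{x. 0 < H.prob {x}}"] by blast
    hence cont: "isCont (cdf H) e" by (simp add: H.isCont_cdf zero_less_measure_iff)
    have e0: "0 < e" using e by simp
    have "\<forall>\<^sub>F n in sequentially. c n < \<alpha> + \<beta> + 1" using c_lim by (rule order_tendstoD) simp
    hence "\<forall>\<^sub>F n in sequentially. cdf (\<nu> n) e \<le> 2 * measure (gamma_max_law n (a n)) {..e * K}"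
      using eventually_ge_at_top[of 1]
    proof eventually_elim
      case (elim n)
      show ?case unfolding cdf_def \<nu>_def
        by (rule max_law_atMost_le[OF _ max_facts]) (use elim e0 in \<open>auto simp: K_def c_def\<close>)
    qed
    moreover have "(\<lambda>n. 2 * measure (gamma_max_law n (a n)) {..e * K}) \<longlonglongrightarrow> 2 * F_cdf \<alpha> (e * K)"
      by (intro tendsto_intros tendsto_gamma_max_law_cdf assms) (use e0 K in auto)
    ultimately have "cdf H e \<le> 2 * F_cdf \<alpha> (e * K)"
      using convH[OF cont] by (intro tendsto_le[OF sequentially_bot]) auto
    also have "\<dots> \<le> 2 * F_cdf \<alpha> (\<delta> * K)"
      using e K by (intro mult_left_mono F_cdf_mono[OF \<alpha>] mult_right_mono) auto
    finally have "cdf H e \<le> 2 * F_cdf \<alpha> (\<delta> * K)" .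
    moreover have "H.prob {..0} \<le> cdf H e"
      unfolding cdf_def using e0 by (intro H.finite_measure_mono) auto
    ultimately show ?thesis by simp
  qed
  \<comment> \<open>The bound \<open>atom\<close> holds for every positive \<delta>; right
    continuity of \<open>F_cdf\<close> at 0, where its value is 0, forces the mass of the
    nonpositive half-line to vanish.\<close>
  have "(F_cdf \<alpha> \<longlongrightarrow> F_cdf \<alpha> 0) (at_right 0)"
    using F_cdf_right_cont[OF \<alpha>, of 0] by (simp add: continuous_within)
  hence F0: "(F_cdf \<alpha> \<longlongrightarrow> 0) (at_right 0)" by (simp add: F_cdf_def)
  have "filterlim (\<lambda>\<delta>. \<delta> * K) (at_right 0) (at_right 0)"
    using K by real_asymp
  hence "((\<lambda>\<delta>. 2 * F_cdf \<alpha> (\<delta> * K)) \<longlongrightarrow> 2 * 0) (at_right 0)"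
    by (intro tendsto_intros filterlim_compose[OF F0])
  moreover have "\<forall>\<^sub>F \<delta> in at_right 0. H.prob {..0} \<le> 2 * F_cdf \<alpha> (\<delta> * K)"
    using eventually_at_right_less[of 0] by eventually_elim (rule atom)
  ultimately have "H.prob {..0} \<le> 2 * 0"
    by (intro tendsto_lowerbound) auto
  hence "H.prob {..0} = 0" using measure_nonneg[of H "{..0}"] by simp
  moreover have "space H - {..0} = {0<..}" by auto
  ultimately have pos: "H.prob {0<..} = 1" using H.prob_compl[of "{..0}"] by simp
  have H_moment: "has_bochner_integral H (\<lambda>x. x ^ k) (m k)" if "1 \<le> k" for k
  proof -
    have "integrable H (\<lambda>x. x ^ k)"
      by (rule H.integrable_power_unit_interval[OF unitH])
    thus ?thesis using mH[OF that] by (simp add: has_bochner_integral_iff)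
  qed
  have "weak_conv_m \<nu> H" unfolding weak_conv_m_def weak_conv_def using convH by blast
  with H pos H_moment F_moment has_bochner_integral_gamma_distribution_power[OF \<gamma>] set_integrable_power_F[OF \<alpha>]
  show ?thesis
    unfolding m_def \<nu>_def exp_int_def by (intro exI[of _ H]) (auto simp: has_bochner_integral_iff)
qed

end
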